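(* Let $G_1,G_2$ be finite groups and let $N_1\unlhd G_1$, $N_2\unlhd G_2$ be normal subgroups. The following are equivalent: (1) $G_i$ is relative almost monomial with respect to $N_i$, for $i=1,2$. (2) $G_1\times G_2$ is relative almost monomial with respect to $N_1\times N_2$.
   Context: All characters are complex characters of finite groups, and $\operatorname{Irr}(G)$ is the set of irreducible characters of $G$. For $H\leqslant G$, $\chi_H$ denotes restriction to $H$ and $\theta^G$ denotes induction from $H$ to $G$. For a character $\chi$ of $G$, $\operatorname{Cons}(\chi):=\{\phi\in\operatorname{Irr}(G):\langle\phi,\chi\rangle>0\}$ is its set of constituents. Let $G$ be a finite group and $N\unlhd G$. The group $G$ is called relative almost monomial with respect to $N$ if for any $\chi\neq\phi\in\operatorname{Irr}(G)$ there exist a subgroup $H$ with $N\subseteq H\leqslant G$ and $\psi\in\operatorname{Irr}(H)$ such that $\psi_N\in\operatorname{Irr}(N)$, $\chi\in\operatorname{Cons}(\psi^G)$ and $\phi\notin\operatorname{Cons}(\psi^G)$. *)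

theory Defs
  imports
    "HOL-Library.Complex_Order"
    "HOL-Algebra.Coset"
    "Jordan_Normal_Form.VS_Connect"
begin

text \<open>
  A complex representation of degree \<open>n\<close> is a homomorphism into
  \<open>GL(n, \<complex>)\<close>, the group of units of the ring of \<open>n \<times> n\<close> matrices.
\<close>

definition group_representation ::
    "('a, 'm) monoid_scheme \<Rightarrow> nat \<Rightarrow> ('a \<Rightarrow> complex mat) \<Rightarrow> bool" where
  "group_representation G n \<rho> \<longleftrightarrow> \<rho> \<in> hom G (units_of (ring_mat TYPE(complex) n ()))"

definition irreducible_representation ::
    "('a, 'm) monoid_scheme \<Rightarrow> nat \<Rightarrow> ('a \<Rightarrow> complex mat) \<Rightarrow> bool" where
  "irreducible_representation G n \<rho> \<longleftrightarrow>
     group_representation G n \<rho> \<and> n > 0 \<and>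
     (\<forall>W. VectorSpace.subspace class_ring W (module_vec TYPE(complex) n) \<longrightarrow>
          (\<forall>g\<in>carrier G. \<forall>w\<in>W. \<rho> g *\<^sub>v w \<in> W) \<longrightarrow>
          W = {0\<^sub>v n} \<or> W = carrier_vec n)"

text \<open>
  Class functions of \<open>G\<close> are total functions that are \<^const>\<open>undefined\<close> outside
  \<open>carrier G\<close>, so that equality of characters is equality of functions on the group.
\<close>

definition rep_character ::
    "('a, 'm) monoid_scheme \<Rightarrow> nat \<Rightarrow> ('a \<Rightarrow> complex mat) \<Rightarrow> 'a \<Rightarrow> complex" where
  "rep_character G n \<rho> = (\<lambda>g\<in>carrier G. \<Sum>i<n. \<rho> g $$ (i, i))"

definition Irr :: "('a, 'm) monoid_scheme \<Rightarrow> ('a \<Rightarrow> complex) set" where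
  "Irr G = {rep_character G n \<rho> | n \<rho>. irreducible_representation G n \<rho>}"

definition char_inner ::
    "('a, 'm) monoid_scheme \<Rightarrow> ('a \<Rightarrow> complex) \<Rightarrow> ('a \<Rightarrow> complex) \<Rightarrow> complex" where
  "char_inner G \<phi> \<chi> = (\<Sum>g\<in>carrier G. \<phi> g * cnj (\<chi> g)) / of_nat (card (carrier G))"

text \<open>
  The order on \<^typ>\<open>complex\<close> is the one of \<^theory>\<open>HOL-Library.Complex_Order\<close>:
  \<open>z > 0\<close> means that \<open>z\<close> is real and positive.
\<close>

definition constituents ::
    "('a, 'm) monoid_scheme \<Rightarrow> ('a \<Rightarrow> complex) \<Rightarrow> ('a \<Rightarrow> complex) set" where
  "constituents G \<chi> = {\<phi> \<in> Irr G. char_inner G \<phi> \<chi> > 0}"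

text \<open>
  Induction from \<open>H\<close> to \<open>G\<close>: the usual formula
  \<open>\<theta>\<^sup>G(g) = 1/|H| \<Sum>\<^bsub>x \<in> G\<^esub> \<theta>\<degree>(x\<^sup>-\<^sup>1 g x)\<close>, where \<open>\<theta>\<degree>\<close> extends \<open>\<theta>\<close> by zero outside \<open>H\<close>.
  Restriction to \<open>H\<close> is \<^term>\<open>restrict \<chi> H\<close>.
\<close>

definition induced ::
    "('a, 'm) monoid_scheme \<Rightarrow> 'a set \<Rightarrow> ('a \<Rightarrow> complex) \<Rightarrow> 'a \<Rightarrow> complex" where
  "induced G H \<theta> = (\<lambda>g\<in>carrier G.
     (\<Sum>x\<in>carrier G.
        if inv\<^bsub>G\<^esub> x \<otimes>\<^bsub>G\<^esub> g \<otimes>\<^bsub>G\<^esub> x \<in> H then \<theta> (inv\<^bsub>G\<^esub> x \<otimes>\<^bsub>G\<^esub> g \<otimes>\<^bsub>G\<^esub> x) else 0)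
     / of_nat (card H))"

definition relative_almost_monomial ::
    "('a, 'm) monoid_scheme \<Rightarrow> 'a set \<Rightarrow> bool" where
  "relative_almost_monomial G N \<longleftrightarrow>
     (\<forall>\<chi>\<in>Irr G. \<forall>\<phi>\<in>Irr G. \<chi> \<noteq> \<phi> \<longrightarrow>
        (\<exists>H \<psi>. subgroup H G \<and> N \<subseteq> H \<and> \<psi> \<in> Irr (G\<lparr>carrier := H\<rparr>) \<and>
           restrict \<psi> N \<in> Irr (G\<lparr>carrier := N\<rparr>) \<and>
           \<chi> \<in> constituents G (induced G H \<psi>) \<and> \<phi> \<notin> constituents G (induced G H \<psi>)))"

end

theory Submission
  imports Defs "Jordan_Normal_Form.Spectral_Radius"
begin

text \<open>
  Write \<open>\<langle>\<phi>, \<psi>\<rangle>\<close> for the inner product of class functions.  By Frobenius reciprocity the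
  condition on a pair \<open>(H, \<psi>)\<close> speaks about \<open>H\<close> only: \<open>\<chi>\<close> is a constituent of \<open>\<psi>\<^sup>G\<close> if and
  only if \<open>\<langle>\<chi>\<^sub>H, \<psi>\<rangle> \<noteq> 0\<close>, because this inner product is a natural number
  (\<open>constituents_induced_iff\<close>).

  From the factors to the product.  Every irreducible character of \<open>G\<^sub>1 \<times> G\<^sub>2\<close> is an outer product
  \<open>\<chi>\<^sub>1 \<times> \<chi>\<^sub>2\<close> of irreducible characters (\<open>Irr_DirProdE\<close>).  If \<open>\<chi>\<^sub>1 \<times> \<chi>\<^sub>2 \<noteq> \<phi>\<^sub>1 \<times> \<phi>\<^sub>2\<close>, then
  \<open>\<chi>\<^sub>1 \<noteq> \<phi>\<^sub>1\<close> or \<open>\<chi>\<^sub>2 \<noteq> \<phi>\<^sub>2\<close>.  In each factor there is a pair \<open>(H\<^sub>i, \<psi>\<^sub>i)\<close> that detects \<open>\<chi>\<^sub>i\<close> and that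
  excludes \<open>\<phi>\<^sub>i\<close> when \<open>\<phi>\<^sub>i \<noteq> \<chi>\<^sub>i\<close>; if \<open>\<chi>\<^sub>i\<close> is the only irreducible character of \<open>G\<^sub>i\<close>, it is
  trivial, and \<open>(G\<^sub>i, \<chi>\<^sub>i)\<close> serves.  The pair \<open>(H\<^sub>1 \<times> H\<^sub>2, \<psi>\<^sub>1 \<times> \<psi>\<^sub>2)\<close> then separates the two
  products, since \<open>\<langle>\<phi>\<^sub>1 \<times> \<phi>\<^sub>2, \<psi>\<^sub>1 \<times> \<psi>\<^sub>2\<rangle> = \<langle>\<phi>\<^sub>1, \<psi>\<^sub>1\<rangle> \<langle>\<phi>\<^sub>2, \<psi>\<^sub>2\<rangle>\<close>.

  From the product to the factors.  The property passes along every surjective homomorphism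
  \<open>\<pi> : G \<rightarrow> Q\<close>, with \<open>\<pi>(N)\<close> in place of \<open>N\<close> (\<open>relative_almost_monomial_image\<close>), and the two
  projections are such homomorphisms.  Given \<open>\<chi> \<noteq> \<phi>\<close> in \<open>Irr Q\<close>, let \<open>(H, \<psi>)\<close> separate \<open>\<chi> \<circ> \<pi>\<close>
  from \<open>\<phi> \<circ> \<pi>\<close>.  As \<open>\<psi>\<close> is not orthogonal to \<open>(\<chi> \<circ> \<pi>)\<^sub>H\<close>, which is constant on the cosets of
  \<open>H \<inter> ker \<pi>\<close>, that kernel acts trivially in the representation that affords \<open>\<psi>\<close>
  (\<open>irreducible_factors_through\<close>).  So \<open>\<psi> = \<psi>' \<circ> \<pi>\<close> with \<open>\<psi>'\<close> irreducible on \<open>\<pi>(H)\<close>, and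
  \<open>(\<pi>(H), \<psi>')\<close> separates \<open>\<chi>\<close> from \<open>\<phi>\<close>.

  The character theory that this uses comes from averaging matrices over the group.  Schur's lemma
  gives the orthogonality relations for matrix entries, hence every irreducible representation spans
  the full matrix algebra, and conversely a representation that does so is irreducible; this makes
  outer tensor products of irreducible representations irreducible.  That nothing else is irreducible
  for \<open>G\<^sub>1 \<times> G\<^sub>2\<close> follows from the regular character, which is a sum of irreducible characters and
  vanishes off the identity.
\<close>

section \<open>Traces and sums of matrices\<close>

text \<open>
  Products of several rectangular matrices are normalised by comparing dimensions.  The conditional
  rules that go through membership in \<^const>\<open>carrier_mat\<close> leave the inner dimension of a product open
  and make the simplifier search for it, so they are replaced by an equivalence.
\<close>

lemma carrier_mat_iff_dim: "A \<in> carrier_mat n m \<longleftrightarrow> dim_row A = n \<and> dim_col A = m"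
  by auto

declare carrier_matD [simp del] mult_carrier_mat [simp del] assoc_mult_mat [simp del]
  assoc_mult_mat_vec [simp del] carrier_mat_iff_dim [simp]

definition mtrace :: "complex mat \<Rightarrow> complex" where
  "mtrace A = (\<Sum>i<dim_row A. A $$ (i, i))"

lemma mtrace_carrier: "A \<in> carrier_mat n n \<Longrightarrow> mtrace A = (\<Sum>i<n. A $$ (i, i))"
  by (auto simp: mtrace_def)

lemma index_mult_mat_sum:
  assumes "A \<in> carrier_mat n m" "B \<in> carrier_mat m k" "i < n" "j < k"
  shows "(A * B) $$ (i, j) = (\<Sum>l<m. A $$ (i, l) * B $$ (l, j))"
  using assms by (auto simp: scalar_prod_def atLeast0LessThan)

lemma index_mult_mat_vec_sum:
  assumes "A \<in> carrier_mat n m" "v \<in> carrier_vec m" "i < n"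
  shows "(A *\<^sub>v v) $ i = (\<Sum>l<m. A $$ (i, l) * v $ l)"
  using assms by (auto simp: scalar_prod_def atLeast0LessThan)

lemma mtrace_comm:
  assumes "A \<in> carrier_mat n m" "B \<in> carrier_mat m n"
  shows "mtrace (A * B) = mtrace (B * A)"
proof -
  have "mtrace (A * B) = (\<Sum>i<n. \<Sum>l<m. A $$ (i, l) * B $$ (l, i))"
    using assms by (auto simp: mtrace_def index_mult_mat_sum[OF assms] intro!: sum.cong simp del: index_mult_mat(1))
  also have "\<dots> = (\<Sum>l<m. \<Sum>i<n. B $$ (l, i) * A $$ (i, l))"
    by (subst sum.swap) (simp add: mult.commute)
  also have "\<dots> = mtrace (B * A)"
    using assms by (auto simp: mtrace_def index_mult_mat_sum[OF assms(2,1)] intro!: sum.cong simp del: index_mult_mat(1))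
  finally show ?thesis .
qed

lemma mtrace_one [simp]: "mtrace (1\<^sub>m n) = of_nat n"
  by (simp add: mtrace_def)

lemma mtrace_add:
  "A \<in> carrier_mat n n \<Longrightarrow> B \<in> carrier_mat n n \<Longrightarrow> mtrace (A + B) = mtrace A + mtrace B"
  by (auto simp: mtrace_def sum.distrib)

text \<open>
  The matrices of all dimensions form one type without a common zero, so that \<^const>\<open>sum\<close> does not
  apply to them; the dimensions are given explicitly.
\<close>

definition mat_sum :: "nat \<Rightarrow> nat \<Rightarrow> 'a set \<Rightarrow> ('a \<Rightarrow> complex mat) \<Rightarrow> complex mat" where
  "mat_sum n m X f = mat n m (\<lambda>(i, j). \<Sum>x\<in>X. f x $$ (i, j))"

lemma mat_sum_carrier [simp]: "mat_sum n m X f \<in> carrier_mat n m"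
  by (simp add: mat_sum_def)

lemma mat_sum_index [simp]:
  "i < n \<Longrightarrow> j < m \<Longrightarrow> mat_sum n m X f $$ (i, j) = (\<Sum>x\<in>X. f x $$ (i, j))"
  by (simp add: mat_sum_def)

lemma mat_sum_dim [simp]: "dim_row (mat_sum n m X f) = n" "dim_col (mat_sum n m X f) = m"
  by (simp_all add: mat_sum_def)

lemma mat_sum_cong: "(\<And>x. x \<in> X \<Longrightarrow> f x = g x) \<Longrightarrow> mat_sum n m X f = mat_sum n m X g"
  by (simp add: mat_sum_def)

lemma mat_sum_reindex:
  "bij_betw h X Y \<Longrightarrow> mat_sum n m X (\<lambda>x. f (h x)) = mat_sum n m Y f"
  by (rule eq_matI) (simp_all add: sum.reindex_bij_betw[of h X Y "\<lambda>x. f x $$ _"])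

lemma mult_mat_sum:
  assumes "C \<in> carrier_mat k n" "\<And>x. x \<in> X \<Longrightarrow> f x \<in> carrier_mat n m"
  shows "C * mat_sum n m X f = mat_sum k m X (\<lambda>x. C * f x)"
proof (rule eq_matI)
  fix i j assume "i < dim_row (mat_sum k m X (\<lambda>x. C * f x))" "j < dim_col (mat_sum k m X (\<lambda>x. C * f x))"
  then have ij: "i < k" "j < m" by simp_all
  have "(C * mat_sum n m X f) $$ (i, j) = (\<Sum>l<n. C $$ (i, l) * (\<Sum>x\<in>X. f x $$ (l, j)))"
    using ij by (simp add: index_mult_mat_sum[OF assms(1) mat_sum_carrier] del: index_mult_mat(1))
  also have "\<dots> = (\<Sum>x\<in>X. \<Sum>l<n. C $$ (i, l) * f x $$ (l, j))"
    by (subst sum.swap) (simp add: sum_distrib_left)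
  also have "\<dots> = (\<Sum>x\<in>X. (C * f x) $$ (i, j))"
    using ij by (intro sum.cong refl) (simp add: index_mult_mat_sum[OF assms] del: index_mult_mat(1))
  finally show "(C * mat_sum n m X f) $$ (i, j) = mat_sum k m X (\<lambda>x. C * f x) $$ (i, j)"
    using ij by simp
qed (use assms in auto)

lemma mat_sum_mult:
  assumes "C \<in> carrier_mat m k" "\<And>x. x \<in> X \<Longrightarrow> f x \<in> carrier_mat n m"
  shows "mat_sum n m X f * C = mat_sum n k X (\<lambda>x. f x * C)"
proof (rule eq_matI)
  fix i j assume "i < dim_row (mat_sum n k X (\<lambda>x. f x * C))" "j < dim_col (mat_sum n k X (\<lambda>x. f x * C))"
  then have ij: "i < n" "j < k" by simp_all
  have "(mat_sum n m X f * C) $$ (i, j) = (\<Sum>l<m. (\<Sum>x\<in>X. f x $$ (i, l)) * C $$ (l, j))"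
    using ij by (simp add: index_mult_mat_sum[OF mat_sum_carrier assms(1)] del: index_mult_mat(1))
  also have "\<dots> = (\<Sum>x\<in>X. \<Sum>l<m. f x $$ (i, l) * C $$ (l, j))"
    by (subst sum.swap) (simp add: sum_distrib_right)
  also have "\<dots> = (\<Sum>x\<in>X. (f x * C) $$ (i, j))"
    using ij by (intro sum.cong refl) (simp add: index_mult_mat_sum[OF assms(2,1)] del: index_mult_mat(1))
  finally show "(mat_sum n m X f * C) $$ (i, j) = mat_sum n k X (\<lambda>x. f x * C) $$ (i, j)"
    using ij by simp
qed (use assms in auto)

lemma mtrace_mat_sum:
  assumes "\<And>x. x \<in> X \<Longrightarrow> f x \<in> carrier_mat n n"
  shows "mtrace (mat_sum n n X f) = (\<Sum>x\<in>X. mtrace (f x))"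
proof -
  have "mtrace (mat_sum n n X f) = (\<Sum>i<n. \<Sum>x\<in>X. f x $$ (i, i))" by (simp add: mtrace_def)
  also have "\<dots> = (\<Sum>x\<in>X. \<Sum>i<n. f x $$ (i, i))" by (rule sum.swap)
  also have "\<dots> = (\<Sum>x\<in>X. mtrace (f x))"
    using assms by (intro sum.cong refl) (simp add: mtrace_carrier[of _ n])
  finally show ?thesis .
qed

section \<open>Subspaces and idempotent matrices\<close>

abbreviation vsubspace :: "nat \<Rightarrow> complex vec set \<Rightarrow> bool" where
  "vsubspace n W \<equiv> VectorSpace.subspace class_ring W (module_vec TYPE(complex) n)"

lemma vsubspace_iff:
  "vsubspace n W \<longleftrightarrow> W \<subseteq> carrier_vec n \<and> 0\<^sub>v n \<in> W \<and>
     (\<forall>v\<in>W. \<forall>w\<in>W. v + w \<in> W) \<and> (\<forall>c. \<forall>v\<in>W. c \<cdot>\<^sub>v v \<in> W)"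
  using vec_module[where 'a=complex, of n] vec_vs[where 'a=complex, of n]
  unfolding VectorSpace.subspace_def submodule_def by (auto simp: module_vec_simps)

lemma assoc_mult_mat_dim:
  fixes A B C :: "complex mat"
  shows "dim_col A = dim_row B \<Longrightarrow> dim_col B = dim_row C \<Longrightarrow> A * B * C = A * (B * C)"
  by (rule assoc_mult_mat[of A "dim_row A" "dim_row B" B "dim_row C" C "dim_col C"]) auto

lemma assoc_mult_mat_vec_dim:
  fixes A B :: "complex mat"
  shows "dim_col A = dim_row B \<Longrightarrow> dim_col B = dim_vec v \<Longrightarrow> A * B *\<^sub>v v = A *\<^sub>v (B *\<^sub>v v)"
  by (rule assoc_mult_mat_vec[of A "dim_row A" "dim_row B" B "dim_vec v"]) auto

lemma vsubspace_sum:
  assumes W: "vsubspace n W" and "finite X" and "\<And>x. x \<in> X \<Longrightarrow> f x \<in> W"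
  shows "vec n (\<lambda>i. \<Sum>x\<in>X. c x * f x $ i) \<in> W"
  using assms(2,3)
proof (induction X rule: finite_induct)
  case empty
  have "vec n (\<lambda>i. \<Sum>x\<in>{}. c x * f x $ i) = 0\<^sub>v n" by auto
  then show ?case using W by (auto simp: vsubspace_iff)
next
  case (insert x X)
  have "f x \<in> carrier_vec n" using insert.prems W by (auto simp: vsubspace_iff)
  then have "vec n (\<lambda>i. \<Sum>x\<in>insert x X. c x * f x $ i) =
      vec n (\<lambda>i. \<Sum>x\<in>X. c x * f x $ i) + c x \<cdot>\<^sub>v f x"
    using insert.hyps by (intro eq_vecI) auto
  then show ?case
    using insert W by (simp add: vsubspace_iff)
qed

lemma vsubspace_mult_vec:
  assumes W: "vsubspace n W" and U: "U \<in> carrier_mat n k" and x: "x \<in> carrier_vec k"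
    and cols: "\<And>l. l < k \<Longrightarrow> col U l \<in> W"
  shows "U *\<^sub>v x \<in> W"
proof -
  have "U *\<^sub>v x = vec n (\<lambda>i. \<Sum>l<k. x $ l * col U l $ i)"
    using U x by (intro eq_vecI) (auto simp: scalar_prod_def atLeast0LessThan mult.commute)
  then show ?thesis using vsubspace_sum[OF W, of "{..<k}" "col U"] cols by simp
qed

lemma vsubspace_diff:
  assumes "vsubspace n W" "v \<in> W" "w \<in> W" shows "v - w \<in> W"
proof -
  have "v - w = v + (- 1) \<cdot>\<^sub>v w"
    using assms by (intro eq_vecI) (auto simp: vsubspace_iff)
  then show ?thesis using assms by (simp add: vsubspace_iff)
qed

text \<open>
  A subspace of dimension \<open>k\<close> is described by an injection \<open>U\<close> of the \<open>k\<close>-dimensional coordinate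
  space onto it and a left inverse \<open>S\<close> of \<open>U\<close>; then \<open>U * S\<close> is a projection onto the subspace.  It is
  enough to find a minimal set \<open>J\<close> of coordinates that determine the elements of the subspace: by
  minimality the subspace contains a basis dual to these coordinates, so \<open>S\<close> can be the selection
  of the coordinates in \<open>J\<close>.
\<close>

lemma vsubspace_coordinates:
  assumes W: "vsubspace n W"
  obtains k U S where "U \<in> carrier_mat n k" "S \<in> carrier_mat k n" "S * U = 1\<^sub>m k"
    "\<And>x. x \<in> carrier_vec k \<Longrightarrow> U *\<^sub>v x \<in> W" "\<And>w. w \<in> W \<Longrightarrow> U *\<^sub>v (S *\<^sub>v w) = w"
proof -
  define P where "P J \<longleftrightarrow> J \<subseteq> {..<n} \<and> (\<forall>w\<in>W. (\<forall>j\<in>J. w $ j = 0) \<longrightarrow> w = 0\<^sub>v n)" for J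
  have "P {..<n}" using W by (auto simp: P_def vsubspace_iff intro!: eq_vecI)
  then obtain J where J: "P J" and J_min: "\<And>J'. P J' \<Longrightarrow> card J \<le> card J'"
    using ex_has_least_nat[of P "{..<n}" card] by blast
  have J_sub: "J \<subseteq> {..<n}" and J_det: "\<And>w. w \<in> W \<Longrightarrow> (\<And>j. j \<in> J \<Longrightarrow> w $ j = 0) \<Longrightarrow> w = 0\<^sub>v n"
    using J by (auto simp: P_def)
  have finJ: "finite J" using J_sub finite_subset by blast
  \<comment> \<open>Without \<open>j\<close> the coordinates no longer suffice, which yields the dual basis vector at \<open>j\<close>.\<close>
  have "\<exists>b\<in>W. \<forall>i\<in>J. b $ i = (if i = j then 1 else 0)" if j: "j \<in> J" for j
  proof -
    have "\<not> P (J - {j})" using J_min[of "J - {j}"] j finJ card_Diff1_less[of J j] by auto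
    then obtain w where w: "w \<in> W" "\<forall>i\<in>J - {j}. w $ i = 0" "w \<noteq> 0\<^sub>v n"
      using J_sub by (auto simp: P_def)
    have "w $ j \<noteq> 0"
      using J_det[OF w(1)] w(2,3) by (metis Diff_iff singletonD)
    moreover have "w \<in> carrier_vec n" using w W by (auto simp: vsubspace_iff)
    ultimately have "(1 / w $ j) \<cdot>\<^sub>v w \<in> W" "\<forall>i\<in>J. ((1 / w $ j) \<cdot>\<^sub>v w) $ i = (if i = j then 1 else 0)"
      using w W J_sub by (auto simp: vsubspace_iff)
    then show ?thesis by blast
  qed
  then obtain b where b: "\<And>j. j \<in> J \<Longrightarrow> b j \<in> W"
      "\<And>j i. j \<in> J \<Longrightarrow> i \<in> J \<Longrightarrow> b j $ i = (if i = j then 1 else 0)"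
    by metis
  obtain f where f: "bij_betw f {..<card J} J"
    using ex_bij_betw_nat_finite[OF finJ] by (auto simp: atLeast0LessThan)
  define k where "k = card J"
  have fJ: "f l \<in> J" "f l < n" if "l < k" for l
    using f that J_sub by (auto simp: k_def bij_betw_def)
  have f_inj: "f l = f m \<longleftrightarrow> l = m" if "l < k" "m < k" for l m
    using f that by (auto simp: k_def bij_betw_def inj_on_def)
  define U where "U = mat n k (\<lambda>(i, l). b (f l) $ i)"
  define S where "S = mat k n (\<lambda>(l, i). if i = f l then 1 else (0::complex))"
  have U: "U \<in> carrier_mat n k" and S: "S \<in> carrier_mat k n" by (auto simp: U_def S_def)
  have Sw: "(S *\<^sub>v w) $ l = w $ f l" if "w \<in> carrier_vec n" "l < k" for w l
    using that fJ S by (simp add: S_def scalar_prod_def if_distrib[of "\<lambda>x. x * _"] sum.delta cong: if_cong)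
  have bU: "col U l = b (f l)" if "l < k" for l
    using that fJ[of l] b(1)[of "f l"] W by (intro eq_vecI) (auto simp: U_def vsubspace_iff)
  show ?thesis
  proof
    show "U \<in> carrier_mat n k" "S \<in> carrier_mat k n" by fact+
    show UW: "U *\<^sub>v x \<in> W" if "x \<in> carrier_vec k" for x
      using that bU b(1) fJ by (intro vsubspace_mult_vec[OF W U]) auto
    show "S * U = 1\<^sub>m k"
    proof (rule eq_matI)
      fix l m assume "l < dim_row (1\<^sub>m k :: complex mat)" "m < dim_col (1\<^sub>m k :: complex mat)"
      then have lm: "l < k" "m < k" by auto
      have "(S * U) $$ (l, m) = (S *\<^sub>v col U m) $ l" using lm S U by simp
      also have "\<dots> = b (f m) $ f l" 
        using lm Sw[OF col_carrier_vec[OF lm(2) U] lm(1)] bU[OF lm(2)] by (simp only:)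
      also have "\<dots> = 1\<^sub>m k $$ (l, m)" using lm b(2) fJ f_inj by simp
      finally show "(S * U) $$ (l, m) = 1\<^sub>m k $$ (l, m)" .
    qed (use S U in auto)
    show "U *\<^sub>v (S *\<^sub>v w) = w" if w: "w \<in> W" for w
    proof -
      have wc: "w \<in> carrier_vec n" using w W by (auto simp: vsubspace_iff)
      have US: "U *\<^sub>v (S *\<^sub>v w) \<in> W" using UW S wc by simp
      have "(U *\<^sub>v (S *\<^sub>v w) - w) $ j = 0" if j: "j \<in> J" for j
      proof -
        have jn: "j < n" using J_sub j by auto
        obtain l where l: "l < k" "f l = j" using f j by (force simp: bij_betw_def k_def)
        have "(U *\<^sub>v (S *\<^sub>v w)) $ j = (\<Sum>m<k. U $$ (j, m) * (S *\<^sub>v w) $ m)"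
          using S wc jn by (intro index_mult_mat_vec_sum[OF U]) auto
        also have "\<dots> = (\<Sum>m<k. if m = l then w $ j else 0)"
          using l jn b(2) fJ f_inj Sw[OF wc] by (intro sum.cong refl) (auto simp: U_def simp del: index_mult_mat_vec)
        also have "\<dots> = w $ j" using l by simp
        finally show ?thesis using jn wc U by simp
      qed
      with J_det[OF vsubspace_diff[OF W US w]] have "U *\<^sub>v (S *\<^sub>v w) - w = 0\<^sub>v n" by blast
      then have "(U *\<^sub>v (S *\<^sub>v w)) $ i = w $ i" if "i < n" for i
        using that wc U by (metis (no_types, lifting) carrier_vecD eq_iff_diff_eq_0 index_minus_vec(1) index_zero_vec(1))
      then show ?thesis using wc U by (intro eq_vecI) auto
    qed
  qed
qed

lemma mat_eqI_mult_vec: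
  fixes A B :: "complex mat"
  assumes "A \<in> carrier_mat n m" "B \<in> carrier_mat n m"
    "\<And>v. v \<in> carrier_vec m \<Longrightarrow> A *\<^sub>v v = B *\<^sub>v v"
  shows "A = B"
proof (rule eq_matI)
  fix i j assume "i < dim_row B" "j < dim_col B"
  then have ij: "i < n" "j < m" using assms(2) by auto
  have "col A j = A *\<^sub>v unit_vec m j" "col B j = B *\<^sub>v unit_vec m j"
    using assms(1,2) ij by (auto simp: scalar_prod_right_unit intro!: eq_vecI)
  then have "col A j $ i = col B j $ i" using assms(3)[of "unit_vec m j"] by simp
  then show "A $$ (i, j) = B $$ (i, j)" using ij assms(1,2) by simp
qed (use assms in auto)

lemma vsubspace_kernel:
  assumes "A \<in> carrier_mat m n" shows "vsubspace n {v \<in> carrier_vec n. A *\<^sub>v v = 0\<^sub>v m}"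
  using assms by (auto simp: vsubspace_iff mult_add_distrib_mat_vec[of A m n] mult_mat_vec[of A m n])

lemma vsubspace_image:
  assumes A: "A \<in> carrier_mat m n" shows "vsubspace m ((*\<^sub>v) A ` carrier_vec n)"
  unfolding vsubspace_iff
proof (intro conjI ballI allI)
  show "0\<^sub>v m \<in> (*\<^sub>v) A ` carrier_vec n"
    using A by (intro image_eqI[of _ _ "0\<^sub>v n"]) auto
  show "v + w \<in> (*\<^sub>v) A ` carrier_vec n"
    if v: "v \<in> (*\<^sub>v) A ` carrier_vec n" and w: "w \<in> (*\<^sub>v) A ` carrier_vec n" for v w
  proof -
    obtain x y where "x \<in> carrier_vec n" "y \<in> carrier_vec n" "v = A *\<^sub>v x" "w = A *\<^sub>v y" using v w by auto
    then show ?thesis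
      using A by (intro image_eqI[of _ _ "x + y"]) (auto simp: mult_add_distrib_mat_vec[of A m n])
  qed
  show "c \<cdot>\<^sub>v v \<in> (*\<^sub>v) A ` carrier_vec n" if v: "v \<in> (*\<^sub>v) A ` carrier_vec n" for c v
  proof -
    obtain x where "x \<in> carrier_vec n" "v = A *\<^sub>v x" using v by auto
    then show ?thesis
      using A by (intro image_eqI[of _ _ "c \<cdot>\<^sub>v x"]) (auto simp: mult_mat_vec[of A m n])
  qed
qed (use A in auto)

lemma vsubspace_fixed:
  assumes "\<And>k. k \<in> K \<Longrightarrow> A k \<in> carrier_mat n n"
  shows "vsubspace n {w \<in> carrier_vec n. \<forall>k\<in>K. A k *\<^sub>v w = w}"
  unfolding vsubspace_iff
proof (intro conjI ballI allI)
  show "0\<^sub>v n \<in> {w \<in> carrier_vec n. \<forall>k\<in>K. A k *\<^sub>v w = w}"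
    using assms by (auto intro!: eq_vecI)
  show "v + w \<in> {w \<in> carrier_vec n. \<forall>k\<in>K. A k *\<^sub>v w = w}"
    if "v \<in> {w \<in> carrier_vec n. \<forall>k\<in>K. A k *\<^sub>v w = w}" "w \<in> {w \<in> carrier_vec n. \<forall>k\<in>K. A k *\<^sub>v w = w}" for v w
    using that mult_add_distrib_mat_vec[OF assms, of _ v w] by simp
  show "c \<cdot>\<^sub>v w \<in> {w \<in> carrier_vec n. \<forall>k\<in>K. A k *\<^sub>v w = w}"
    if "w \<in> {w \<in> carrier_vec n. \<forall>k\<in>K. A k *\<^sub>v w = w}" for c w
    using that mult_mat_vec[OF assms, of _ w c] by simp
qed auto

text \<open>
  With coordinates \<open>U\<close>, \<open>S\<close> for the image of \<open>P\<close>, the trace of \<open>P = U * (S * P)\<close> is that of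
  \<open>S * P * U = S * U\<close>, an identity matrix.
\<close>

lemma mtrace_idempotent:
  assumes P: "P \<in> carrier_mat n n" and idem: "P * P = P"
  obtains k where "mtrace P = of_nat k"
proof -
  obtain k U S where U: "U \<in> carrier_mat n k" and S: "S \<in> carrier_mat k n" and SU: "S * U = 1\<^sub>m k"
    and UW: "\<And>x. x \<in> carrier_vec k \<Longrightarrow> U *\<^sub>v x \<in> (*\<^sub>v) P ` carrier_vec n"
    and US: "\<And>w. w \<in> (*\<^sub>v) P ` carrier_vec n \<Longrightarrow> U *\<^sub>v (S *\<^sub>v w) = w"
    using vsubspace_coordinates[OF vsubspace_image[OF P]] by metis
  have PU: "P * U = U"
  proof (rule mat_eqI_mult_vec)
    fix v :: "complex vec" assume v: "v \<in> carrier_vec k"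
    obtain y where y: "y \<in> carrier_vec n" "U *\<^sub>v v = P *\<^sub>v y" using UW[OF v] by auto
    have "P *\<^sub>v (P *\<^sub>v y) = P *\<^sub>v y" using assoc_mult_mat_vec[OF P P y(1)] idem by simp
    then show "(P * U) *\<^sub>v v = U *\<^sub>v v" using y assoc_mult_mat_vec[OF P U v] by simp
  qed (use P U in auto)
  have USP: "U * (S * P) = P"
  proof (rule mat_eqI_mult_vec)
    fix v :: "complex vec" assume v: "v \<in> carrier_vec n"
    have "U *\<^sub>v (S *\<^sub>v (P *\<^sub>v v)) = P *\<^sub>v v" using v by (intro US) auto
    then show "(U * (S * P)) *\<^sub>v v = P *\<^sub>v v"
      using v P U S by (simp add: assoc_mult_mat_vec[of _ n k _ n] assoc_mult_mat_vec[of _ k n _ n])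
  qed (use P U S in auto)
  have "mtrace P = mtrace (U * (S * P))" by (simp add: USP)
  also have "\<dots> = mtrace (S * P * U)" using U S P by (intro mtrace_comm[of _ n k]) auto
  also have "S * P * U = 1\<^sub>m k" using assoc_mult_mat[OF S P U] PU SU by simp
  finally show ?thesis using that[of k] by simp
qed

text \<open>
  Coordinates of a subspace together with coordinates of a complement, in block form: the columns of
  \<open>U\<close> and \<open>U'\<close> form a basis, and the rows of \<open>S\<close> and \<open>S'\<close> form the dual basis.  The complement is
  the kernel of \<open>S\<close>.
\<close>

lemma vsubspace_splitting:
  assumes W: "vsubspace n W" and W0: "W \<noteq> {0\<^sub>v n}" and W1: "W \<noteq> carrier_vec n"
  obtains k l U S U' S' where
    "U \<in> carrier_mat n k" "S \<in> carrier_mat k n" "U' \<in> carrier_mat n l" "S' \<in> carrier_mat l n"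
    "S * U = 1\<^sub>m k" "S' * U' = 1\<^sub>m l" "S' * U = 0\<^sub>m l k" "U * S + U' * S' = 1\<^sub>m n"
    "k < n" "l < n"
    "\<And>x. x \<in> carrier_vec k \<Longrightarrow> U *\<^sub>v x \<in> W" "\<And>w. w \<in> W \<Longrightarrow> U *\<^sub>v (S *\<^sub>v w) = w"
proof -
  obtain k U S where U: "U \<in> carrier_mat n k" and S: "S \<in> carrier_mat k n" and SU: "S * U = 1\<^sub>m k"
    and UW: "\<And>x. x \<in> carrier_vec k \<Longrightarrow> U *\<^sub>v x \<in> W" and USw: "\<And>w. w \<in> W \<Longrightarrow> U *\<^sub>v (S *\<^sub>v w) = w"
    by (rule vsubspace_coordinates[OF W]) (rule that)
  obtain l U' T where U': "U' \<in> carrier_mat n l" and T: "T \<in> carrier_mat l n" and TU': "T * U' = 1\<^sub>m l"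
    and U'K: "\<And>x. x \<in> carrier_vec l \<Longrightarrow> U' *\<^sub>v x \<in> {v \<in> carrier_vec n. S *\<^sub>v v = 0\<^sub>v k}"
    and UTw: "\<And>w. w \<in> {v \<in> carrier_vec n. S *\<^sub>v v = 0\<^sub>v k} \<Longrightarrow> U' *\<^sub>v (T *\<^sub>v w) = w"
    by (rule vsubspace_coordinates[OF vsubspace_kernel[OF S]]) (rule that)
  \<comment> \<open>\<open>Q\<close> projects onto the kernel of \<open>S\<close> along \<open>W\<close>; composing \<open>T\<close> with it makes \<open>S'\<close> vanish on \<open>W\<close>.\<close>
  define Q where "Q = 1\<^sub>m n - U * S"
  define S' where "S' = T * Q"
  note US = mult_carrier_mat[OF U S]
  have Q: "Q \<in> carrier_mat n n" using U S by (auto simp: Q_def)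
  then have S': "S' \<in> carrier_mat l n" using T by (auto simp: S'_def)
  note dims [simp] = carrier_matD[OF U] carrier_matD[OF S] carrier_matD[OF U'] carrier_matD[OF T]
  note dims' [simp] = carrier_matD[OF Q] carrier_matD[OF S']
  have SU': "S * U' = 0\<^sub>m k l"
  proof (rule mat_eqI_mult_vec[of _ k l])
    fix v :: "complex vec" assume v: "v \<in> carrier_vec l"
    have "S *\<^sub>v (U' *\<^sub>v v) = 0\<^sub>v k" using U'K[OF v] by blast
    then show "S * U' *\<^sub>v v = 0\<^sub>m k l *\<^sub>v v" using v assoc_mult_mat_vec[OF S U' v] by auto
  qed (use mult_carrier_mat[OF S U'] in simp_all)
  have SQ: "S * Q = 0\<^sub>m k n"
  proof -
    have "S * Q = S - S * U * S"
      using S by (simp add: Q_def mult_minus_distrib_mat[OF S one_carrier_mat US] assoc_mult_mat_dim)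
    also have "\<dots> = 0\<^sub>m k n" using SU S by (simp add: minus_r_inv_mat[OF S])
    finally show ?thesis .
  qed
  have QU: "Q * U = 0\<^sub>m n k"
  proof -
    have "Q * U = U - U * (S * U)"
      using U by (simp add: Q_def minus_mult_distrib_mat[OF one_carrier_mat US U] assoc_mult_mat_dim)
    also have "\<dots> = 0\<^sub>m n k" using SU U by (simp add: minus_r_inv_mat[OF U])
    finally show ?thesis .
  qed
  have QU': "Q * U' = U'"
  proof -
    have "Q * U' = U' - U * (S * U')"
      using U' by (simp add: Q_def minus_mult_distrib_mat[OF one_carrier_mat US U'] assoc_mult_mat_dim)
    then show ?thesis using U U' SU' by (auto intro!: eq_matI)
  qed
  have U'S': "U' * S' = Q"
  proof (rule mat_eqI_mult_vec[of _ n n])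
    fix v :: "complex vec" assume v: "v \<in> carrier_vec n"
    have "S *\<^sub>v (Q *\<^sub>v v) = 0\<^sub>v k"
      using v by (subst assoc_mult_mat_vec[OF S Q v, symmetric]) (auto simp: SQ intro!: eq_vecI)
    then have "U' *\<^sub>v (T *\<^sub>v (Q *\<^sub>v v)) = Q *\<^sub>v v" using v Q by (intro UTw) auto
    then show "U' * S' *\<^sub>v v = Q *\<^sub>v v" using v by (simp add: S'_def assoc_mult_mat_vec_dim)
  qed (use mult_carrier_mat[OF U' S'] Q in simp_all)
  have S'U': "S' * U' = 1\<^sub>m l" using QU' TU' by (simp add: S'_def assoc_mult_mat_dim)
  have S'U: "S' * U = 0\<^sub>m l k" using QU T by (simp add: S'_def assoc_mult_mat_dim)
  have one: "U * S + U' * S' = 1\<^sub>m n" 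
    using US by (intro eq_matI) (auto simp: U'S' Q_def simp del: index_mult_mat(1))
  \<comment> \<open>Taking traces gives \<open>n = k + l\<close>, so \<open>k < n\<close> and \<open>l < n\<close> amount to \<open>l\<close> and \<open>k\<close> being nonzero.\<close>
  have "mtrace (U * S + U' * S') = mtrace (U * S) + mtrace (U' * S')"
    using U S U' S' by (intro mtrace_add[of _ n]) auto
  also have "\<dots> = mtrace (S * U) + mtrace (S' * U')"
    using mtrace_comm[OF U S] mtrace_comm[OF U' S'] by simp
  finally have "(of_nat n :: complex) = of_nat (k + l)" by (simp add: one SU S'U')
  then have nkl: "n = k + l" by (simp only: of_nat_eq_iff)
  have "k \<noteq> 0"
  proof
    assume k: "k = 0"
    have "w = 0\<^sub>v n" if w: "w \<in> W" for w
    proof -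
      have "U *\<^sub>v (S *\<^sub>v w) = 0\<^sub>v n" using k by (intro eq_vecI) (auto simp: scalar_prod_def)
      then show ?thesis using USw[OF w] by simp
    qed
    then show False using W0 W by (auto simp: vsubspace_iff)
  qed
  moreover have "l \<noteq> 0"
  proof
    assume l: "l = 0"
    have "v \<in> W" if v: "v \<in> carrier_vec n" for v
    proof -
      have "U' * S' = 0\<^sub>m n n" using l by (intro eq_matI) (auto simp: scalar_prod_def)
      then have "U * S = 1\<^sub>m n" using one U S by auto
      then have "U *\<^sub>v (S *\<^sub>v v) = v" using v assoc_mult_mat_vec[OF U S v] by simp
      then show ?thesis using UW[of "S *\<^sub>v v"] S v by simp
    qed
    then show False using W1 W by (auto simp: vsubspace_iff)
  qed
  ultimately show ?thesis
    using nkl by (intro that[OF U S U' S' SU S'U' S'U one _ _ UW USw]) auto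
qed

section \<open>Representations of finite groups\<close>

locale finite_group = group G for G :: "('a, 'm) monoid_scheme" (structure) +
  assumes fin [simp]: "finite (carrier G)"
begin

lemma card_pos: "card (carrier G) > 0"
  using one_closed by (auto simp: card_gt_0_iff)

lemma bij_betw_lmult: "h \<in> carrier G \<Longrightarrow> bij_betw (\<lambda>g. h \<otimes> g) (carrier G) (carrier G)"
  by (rule bij_betw_byWitness[of _ "\<lambda>g. inv h \<otimes> g"]) (auto simp: m_assoc[symmetric])

lemma bij_betw_conj: "h \<in> carrier G \<Longrightarrow> bij_betw (\<lambda>g. inv h \<otimes> g \<otimes> h) (carrier G) (carrier G)"
proof (rule bij_betw_byWitness[of _ "\<lambda>g. h \<otimes> g \<otimes> inv h"])
  assume h: "h \<in> carrier G"
  show "\<forall>g\<in>carrier G. h \<otimes> (inv h \<otimes> g \<otimes> h) \<otimes> inv h = g"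
    using h by (auto simp: m_assoc) (simp add: m_assoc[symmetric])
  show "\<forall>g\<in>carrier G. inv h \<otimes> (h \<otimes> g \<otimes> inv h) \<otimes> h = g"
    using h by (auto simp: m_assoc) (simp add: m_assoc[symmetric])
qed auto

lemma finite_group_subgroup: "subgroup H G \<Longrightarrow> finite_group (G\<lparr>carrier := H\<rparr>)"
  using subgroup.subgroup_is_group[OF _ is_group] subgroup.subset[of H G] finite_subset[OF _ fin]
  by (auto simp: finite_group_def finite_group_axioms_def)

end

text \<open>
  The matrices are automatically units, as \<open>\<rho> (inv g)\<close> is the inverse of \<open>\<rho> g\<close>.
\<close>

lemma group_representation_iff:
  assumes "group G"
  shows "group_representation G n \<rho> \<longleftrightarrow>
    (\<forall>g\<in>carrier G. \<rho> g \<in> carrier_mat n n) \<and>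
    (\<forall>g\<in>carrier G. \<forall>h\<in>carrier G. \<rho> (g \<otimes>\<^bsub>G\<^esub> h) = \<rho> g * \<rho> h) \<and> \<rho> \<one>\<^bsub>G\<^esub> = 1\<^sub>m n"
    (is "_ \<longleftrightarrow> ?R")
proof
  interpret G: group G by fact
  interpret R: ring "ring_mat TYPE(complex) n ()" by (rule ring_mat)
  have U: "group (units_of (ring_mat TYPE(complex) n ()))" by (rule R.units_group)
  {
    assume "group_representation G n \<rho>"
    then have h: "\<rho> \<in> hom G (units_of (ring_mat TYPE(complex) n ()))"
      by (simp add: group_representation_def)
    then have "\<rho> \<one>\<^bsub>G\<^esub> = \<one>\<^bsub>units_of (ring_mat TYPE(complex) n ())\<^esub>"
      by (rule hom_one[OF _ assms U])
    then show ?R using h R.Units_closed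
      by (auto simp: hom_def units_of_def Pi_iff ring_mat_def)
  next
    assume R: ?R
    have "\<rho> g \<in> Units (ring_mat TYPE(complex) n ())" if "g \<in> carrier G" for g
    proof -
      have "\<rho> g * \<rho> (inv\<^bsub>G\<^esub> g) = 1\<^sub>m n" "\<rho> (inv\<^bsub>G\<^esub> g) * \<rho> g = 1\<^sub>m n"
        using R that by (metis G.inv_closed G.r_inv G.l_inv)+
      then show ?thesis using R that
        by (auto simp: Units_def ring_mat_def intro!: bexI[of _ "\<rho> (inv\<^bsub>G\<^esub> g)"])
    qed
    then show "group_representation G n \<rho>"
      using R by (auto simp: group_representation_def hom_def units_of_def ring_mat_def)
  }
qed

locale representation = finite_group G for G :: "('a, 'm) monoid_scheme" (structure) +
  fixes n :: nat and \<rho> :: "'a \<Rightarrow> complex mat"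
  assumes rep: "group_representation G n \<rho>"
begin

lemma closed [simp]: "g \<in> carrier G \<Longrightarrow> \<rho> g \<in> carrier_mat n n"
  and mult: "g \<in> carrier G \<Longrightarrow> h \<in> carrier G \<Longrightarrow> \<rho> (g \<otimes> h) = \<rho> g * \<rho> h"
  and one [simp]: "\<rho> \<one> = 1\<^sub>m n"
  using rep by (auto simp: group_representation_iff[OF is_group])

lemma dim [simp]: "g \<in> carrier G \<Longrightarrow> dim_row (\<rho> g) = n" "g \<in> carrier G \<Longrightarrow> dim_col (\<rho> g) = n"
  using closed carrier_matD by blast+

lemma mult_inv: "g \<in> carrier G \<Longrightarrow> \<rho> g * \<rho> (inv g) = 1\<^sub>m n" "g \<in> carrier G \<Longrightarrow> \<rho> (inv g) * \<rho> g = 1\<^sub>m n"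
  using mult[of g "inv g"] mult[of "inv g" g] by simp_all

lemma character_eq_mtrace: "g \<in> carrier G \<Longrightarrow> rep_character G n \<rho> g = mtrace (\<rho> g)"
  by (simp add: rep_character_def mtrace_def)

lemma character_conj:
  assumes "g \<in> carrier G" "x \<in> carrier G"
  shows "rep_character G n \<rho> (inv x \<otimes> g \<otimes> x) = rep_character G n \<rho> g"
proof -
  have "mtrace (\<rho> (inv x \<otimes> g \<otimes> x)) = mtrace (\<rho> (inv x \<otimes> g) * \<rho> x)"
    using assms by (simp add: mult)
  also have "\<dots> = mtrace (\<rho> x * \<rho> (inv x \<otimes> g))"
    using assms by (intro mtrace_comm[of _ n n]) auto
  also have "\<rho> x * \<rho> (inv x \<otimes> g) = \<rho> g"
    using assms by (simp add: mult[symmetric] m_assoc[symmetric])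
  finally show ?thesis using assms by (simp add: character_eq_mtrace)
qed

lemma character_one: "rep_character G n \<rho> \<one> = of_nat n"
  by (simp add: character_eq_mtrace)

end

locale irreducible_rep = representation +
  assumes irreducible: "irreducible_representation G n \<rho>"
begin

lemma degree_pos: "n > 0"
  using irreducible by (simp add: irreducible_representation_def)

lemma invariant_subspace:
  assumes "vsubspace n W" "\<And>g w. g \<in> carrier G \<Longrightarrow> w \<in> W \<Longrightarrow> \<rho> g *\<^sub>v w \<in> W"
  shows "W = {0\<^sub>v n} \<or> W = carrier_vec n"
  using irreducible assms unfolding irreducible_representation_def by blast

lemma character_in_Irr: "rep_character G n \<rho> \<in> Irr G"
  using irreducible by (auto simp: Irr_def)

end

lemma (in finite_group) irreducible_repI:
  "irreducible_representation G n \<rho> \<Longrightarrow> irreducible_rep G n \<rho>"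
  by unfold_locales (simp_all add: irreducible_representation_def)

lemma (in finite_group) IrrE:
  assumes "\<chi> \<in> Irr G"
  obtains n \<rho> where "irreducible_rep G n \<rho>" "\<chi> = rep_character G n \<rho>"
  using assms irreducible_repI by (auto simp: Irr_def)

lemma (in finite_group) representationI:
  assumes "\<And>g. g \<in> carrier G \<Longrightarrow> \<rho> g \<in> carrier_mat n n"
    and "\<And>g h. g \<in> carrier G \<Longrightarrow> h \<in> carrier G \<Longrightarrow> \<rho> (g \<otimes> h) = \<rho> g * \<rho> h" and "\<rho> \<one> = 1\<^sub>m n"
  shows "representation G n \<rho>"
  using assms by unfold_locales (simp add: group_representation_iff[OF is_group])

section \<open>Schur's lemma and the orthogonality of matrix entries\<close>

text \<open>
  An eigenspace of a matrix that commutes with the representation is invariant, so it is the whole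
  space.
\<close>

lemma (in irreducible_rep) schur_scalar:
  assumes A: "A \<in> carrier_mat n n" and comm: "\<And>g. g \<in> carrier G \<Longrightarrow> A * \<rho> g = \<rho> g * A"
  obtains c where "A = c \<cdot>\<^sub>m 1\<^sub>m n"
proof -
  obtain c v where v: "v \<in> carrier_vec n" "v \<noteq> 0\<^sub>v n" "A *\<^sub>v v = c \<cdot>\<^sub>v v"
    using spectrum_non_empty[OF A degree_pos] A
    by (auto simp: spectrum_def eigenvalue_def eigenvector_def)
  define W where "W = {w \<in> carrier_vec n. A *\<^sub>v w = c \<cdot>\<^sub>v w}"
  have "vsubspace n W"
    using A by (auto simp: W_def vsubspace_iff mult_add_distrib_mat_vec[OF A] mult_mat_vec[OF A]
        smult_add_distrib_vec smult_smult_assoc mult.commute)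
  moreover have "\<rho> g *\<^sub>v w \<in> W" if g: "g \<in> carrier G" and w: "w \<in> W" for g w
  proof -
    have wn: "w \<in> carrier_vec n" "A *\<^sub>v w = c \<cdot>\<^sub>v w" using w by (auto simp: W_def)
    have "A *\<^sub>v (\<rho> g *\<^sub>v w) = \<rho> g *\<^sub>v (A *\<^sub>v w)"
      using comm[OF g] assoc_mult_mat_vec[OF A closed[OF g] wn(1)]
        assoc_mult_mat_vec[OF closed[OF g] A wn(1)] by simp
    then show ?thesis using wn mult_mat_vec[OF closed[OF g] wn(1)] closed[OF g] by (auto simp: W_def)
  qed
  ultimately have "W = {0\<^sub>v n} \<or> W = carrier_vec n" by (rule invariant_subspace)
  moreover have "v \<in> W" using v by (simp add: W_def)
  ultimately have W: "W = carrier_vec n" using v by auto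
  have "A = c \<cdot>\<^sub>m 1\<^sub>m n"
  proof (rule mat_eqI_mult_vec[of _ n n])
    fix w :: "complex vec" assume w: "w \<in> carrier_vec n"
    then have "A *\<^sub>v w = c \<cdot>\<^sub>v w" using W by (auto simp: W_def)
    then show "A *\<^sub>v w = (c \<cdot>\<^sub>m 1\<^sub>m n) *\<^sub>v w" using w by (auto intro!: eq_vecI)
  qed (use A in auto)
  then show ?thesis by (rule that)
qed

text \<open>
  Replacing \<open>g\<close> by \<open>h * g\<close> permutes the summands, so averaging turns an arbitrary matrix into an
  intertwiner.
\<close>

lemma average_intertwines:
  assumes "representation G n \<rho>" "representation G m \<sigma>" and E: "E \<in> carrier_mat n m"
  defines "T \<equiv> mat_sum n m (carrier G) (\<lambda>g. \<rho> g * E * \<sigma> (inv\<^bsub>G\<^esub> g))"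
  assumes h: "h \<in> carrier G"
  shows "\<rho> h * T = T * \<sigma> h"
proof -
  interpret R: representation G n \<rho> by fact
  interpret S: representation G m \<sigma> by fact
  note Ed [simp] = carrier_matD[OF E]
  have c: "\<rho> g * E * \<sigma> (inv\<^bsub>G\<^esub> g) \<in> carrier_mat n m" if "g \<in> carrier G" for g
    using that by (intro carrier_matI) auto
  have "T * \<sigma> h = mat_sum n m (carrier G) (\<lambda>g. \<rho> g * E * \<sigma> (inv\<^bsub>G\<^esub> g) * \<sigma> h)"
    using h c by (simp add: T_def mat_sum_mult[of _ m m])
  also have "\<dots> = mat_sum n m (carrier G)
      (\<lambda>g. \<rho> (h \<otimes>\<^bsub>G\<^esub> g) * E * \<sigma> (inv\<^bsub>G\<^esub> (h \<otimes>\<^bsub>G\<^esub> g)) * \<sigma> h)"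
    by (rule mat_sum_reindex[OF R.bij_betw_lmult[OF h], symmetric])
  also have "\<dots> = mat_sum n m (carrier G) (\<lambda>g. \<rho> h * (\<rho> g * E * \<sigma> (inv\<^bsub>G\<^esub> g)))"
  proof (rule mat_sum_cong)
    fix g assume g: "g \<in> carrier G"
    have "\<sigma> (inv\<^bsub>G\<^esub> (h \<otimes>\<^bsub>G\<^esub> g)) * \<sigma> h = \<sigma> (inv\<^bsub>G\<^esub> g)"
      using g h by (simp add: S.mult[symmetric] R.inv_mult_group R.m_assoc)
    then show "\<rho> (h \<otimes>\<^bsub>G\<^esub> g) * E * \<sigma> (inv\<^bsub>G\<^esub> (h \<otimes>\<^bsub>G\<^esub> g)) * \<sigma> h = \<rho> h * (\<rho> g * E * \<sigma> (inv\<^bsub>G\<^esub> g))"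
      using g h by (simp add: R.mult assoc_mult_mat_dim)
  qed
  also have "\<dots> = \<rho> h * T" using h c by (simp add: T_def mult_mat_sum[of _ n n])
  finally show ?thesis by simp
qed

definition matrix_unit :: "nat \<Rightarrow> nat \<Rightarrow> nat \<Rightarrow> nat \<Rightarrow> complex mat" where
  "matrix_unit n m i j = mat n m (\<lambda>(a, b). if a = i \<and> b = j then 1 else 0)"

lemma matrix_unit_carrier: "matrix_unit n m i j \<in> carrier_mat n m"
  and matrix_unit_dim [simp]: "dim_row (matrix_unit n m i j) = n" "dim_col (matrix_unit n m i j) = m"
  by (simp_all add: matrix_unit_def)

lemma matrix_unit_sandwich:
  assumes A: "A \<in> carrier_mat p n" and B: "B \<in> carrier_mat m q"
    and "i < n" "j < m" "a < p" "b < q"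
  shows "(A * matrix_unit n m i j * B) $$ (a, b) = A $$ (a, i) * B $$ (j, b)"
proof -
  have col: "(A * matrix_unit n m i j) $$ (a, l) = (if l = j then A $$ (a, i) else 0)" if "l < m" for l
  proof -
    have "(A * matrix_unit n m i j) $$ (a, l) = (\<Sum>k<n. A $$ (a, k) * matrix_unit n m i j $$ (k, l))"
      using assms that by (intro index_mult_mat_sum[OF A]) auto
    also have "\<dots> = (\<Sum>k<n. if k = i then (if l = j then A $$ (a, i) else 0) else 0)"
      using that by (intro sum.cong refl) (auto simp: matrix_unit_def)
    also have "\<dots> = (if l = j then A $$ (a, i) else 0)" using assms by simp
    finally show ?thesis .
  qed
  have "(A * matrix_unit n m i j * B) $$ (a, b) = (\<Sum>l<m. (A * matrix_unit n m i j) $$ (a, l) * B $$ (l, b))"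
    using assms by (intro index_mult_mat_sum[OF mult_carrier_mat[OF A matrix_unit_carrier] B]) auto
  also have "\<dots> = (\<Sum>l<m. if l = j then A $$ (a, i) * B $$ (j, b) else 0)"
    by (intro sum.cong refl) (auto simp: col simp del: index_mult_mat)
  also have "\<dots> = A $$ (a, i) * B $$ (j, b)" using assms by simp
  finally show ?thesis .
qed

text \<open>
  The left-hand side is an entry of the average of a matrix unit.  By Schur's lemma this average is
  scalar, and its trace determines the scalar.
\<close>

lemma (in irreducible_rep) schur_orthogonality:
  assumes "a < n" "b < n" "i < n" "j < n"
  shows "(\<Sum>g\<in>carrier G. \<rho> g $$ (a, i) * \<rho> (inv g) $$ (j, b)) =
    (if a = b \<and> i = j then of_nat (card (carrier G)) / of_nat n else 0)"
proof -
  define T where "T = mat_sum n n (carrier G) (\<lambda>g. \<rho> g * matrix_unit n n i j * \<rho> (inv g))"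
  have "\<rho> g * T = T * \<rho> g" if "g \<in> carrier G" for g
    unfolding T_def using that representation_axioms
    by (intro average_intertwines) auto
  then obtain c where c: "T = c \<cdot>\<^sub>m 1\<^sub>m n"
    using schur_scalar[of T] by (metis T_def mat_sum_carrier)
  have "mtrace T = (\<Sum>g\<in>carrier G. mtrace (\<rho> g * matrix_unit n n i j * \<rho> (inv g)))"
    unfolding T_def by (rule mtrace_mat_sum) (auto intro!: mult_carrier_mat[of _ n n])
  also have "\<dots> = (\<Sum>g\<in>carrier G. mtrace (matrix_unit n n i j))"
  proof (rule sum.cong[OF refl])
    fix g assume g: "g \<in> carrier G"
    have "mtrace (\<rho> g * matrix_unit n n i j * \<rho> (inv g)) = mtrace (\<rho> (inv g) * (\<rho> g * matrix_unit n n i j))"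
      using g by (intro mtrace_comm[of _ n n]) (auto intro!: mult_carrier_mat[of _ n n])
    also have "\<rho> (inv g) * (\<rho> g * matrix_unit n n i j) = matrix_unit n n i j"
      using g assoc_mult_mat[OF closed closed matrix_unit_carrier, of "inv g" g n i j]
        left_mult_one_mat[OF matrix_unit_carrier, of n n i j] by (simp add: mult_inv)
    finally show "mtrace (\<rho> g * matrix_unit n n i j * \<rho> (inv g)) = mtrace (matrix_unit n n i j)" .
  qed
  also have "mtrace (matrix_unit n n i j) = (if i = j then 1 else 0)"
    using assms by (auto simp: mtrace_def matrix_unit_def sum.delta cong: if_cong)
  finally have "of_nat n * c = (if i = j then of_nat (card (carrier G)) else 0)"
    by (simp add: c mtrace_def mult.commute)
  then have cval: "c = (if i = j then of_nat (card (carrier G)) / of_nat n else 0)"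
    using degree_pos by (auto simp: field_simps)
  have "(\<Sum>g\<in>carrier G. \<rho> g $$ (a, i) * \<rho> (inv g) $$ (j, b)) = T $$ (a, b)"
    using assms by (simp add: T_def matrix_unit_sandwich[of _ n n _ n n] del: index_mult_mat(1))
  also have "\<dots> = (if a = b then c else 0)" using assms by (simp add: c)
  finally show ?thesis by (simp add: cval)
qed

section \<open>Decomposition into irreducible characters\<close>

text \<open>
  Compressing a representation to a direct summand of the space is multiplicative as soon as the
  component in the complement, which is cut out by \<open>1 - U * S\<close>, contributes nothing.  This holds for an
  invariant subspace and for the quotient by it, hence the weak form of the assumption.
\<close>

lemma (in representation) subrepresentation:
  assumes U: "U \<in> carrier_mat n k" and S: "S \<in> carrier_mat k n" and SU: "S * U = 1\<^sub>m k"
    and inv: "\<And>g h. g \<in> carrier G \<Longrightarrow> h \<in> carrier G \<Longrightarrow>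
      S * \<rho> g * (1\<^sub>m n - U * S) * \<rho> h * U = 0\<^sub>m k k"
  shows "representation G k (\<lambda>g. S * \<rho> g * U)"
proof (rule representationI)
  note d [simp] = carrier_matD[OF U] carrier_matD[OF S]
  show "S * \<rho> g * U \<in> carrier_mat k k" if "g \<in> carrier G" for g
    using that by (intro carrier_matI) auto
  show "S * \<rho> \<one> * U = 1\<^sub>m k" using S SU by simp
  show "S * \<rho> (g \<otimes> h) * U = S * \<rho> g * U * (S * \<rho> h * U)" if g: "g \<in> carrier G" and h: "h \<in> carrier G" for g h
  proof -
    define A where "A = S * \<rho> g"
    define B where "B = \<rho> h * U"
    have A: "A \<in> carrier_mat k n" and B: "B \<in> carrier_mat n k"
      using g h U S by (auto simp: A_def B_def)
    have US: "U * S \<in> carrier_mat n n" using U S by simp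
    note d' [simp] = carrier_matD[OF A] carrier_matD[OF B]
    have "A * (1\<^sub>m n - U * S) * B = A * B - A * (U * S) * B"
      using A by (simp add: mult_minus_distrib_mat[OF A one_carrier_mat US]
          minus_mult_distrib_mat[OF A mult_carrier_mat[OF A US] B])
    moreover have "A * (1\<^sub>m n - U * S) * B = 0\<^sub>m k k"
      using inv[OF g h] g h by (simp add: A_def B_def assoc_mult_mat_dim)
    ultimately have z: "A * B - A * (U * S) * B = 0\<^sub>m k k" by simp
    have "A * B = A * (U * S) * B"
    proof (rule eq_matI)
      fix i j assume "i < dim_row (A * (U * S) * B)" "j < dim_col (A * (U * S) * B)"
      then have ij: "i < k" "j < k" by auto
      have "(A * B - A * (U * S) * B) $$ (i, j) = (A * B) $$ (i, j) - (A * (U * S) * B) $$ (i, j)"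
        using ij by (intro index_minus_mat) auto
      then show "(A * B) $$ (i, j) = (A * (U * S) * B) $$ (i, j)" using z ij by simp
    qed auto
    then show ?thesis using g h by (simp add: A_def B_def mult assoc_mult_mat_dim)
  qed
qed

text \<open>
  If \<open>W\<close> is a nontrivial invariant subspace, the trace is the sum of the traces on \<open>W\<close> and on the
  quotient by \<open>W\<close>, both of smaller degree.  The irreducible characters are collected in a list to keep their multiplicities.
\<close>

lemma (in representation) character_decomposition:
  "\<exists>xs. set xs \<subseteq> Irr G \<and> (\<forall>g\<in>carrier G. mtrace (\<rho> g) = (\<Sum>\<chi>\<leftarrow>xs. \<chi> g))"
  using representation_axioms
proof (induction n arbitrary: \<rho> rule: less_induct)
  case (less n)
  interpret R: representation G n \<rho> by fact
  consider "n = 0" | "irreducible_representation G n \<rho>" |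
    W where "n > 0" "vsubspace n W" "\<And>g w. g \<in> carrier G \<Longrightarrow> w \<in> W \<Longrightarrow> \<rho> g *\<^sub>v w \<in> W"
      "W \<noteq> {0\<^sub>v n}" "W \<noteq> carrier_vec n"
    using R.rep neq0_conv[of n] unfolding irreducible_representation_def by blast
  then show ?case
  proof cases
    case 1
    then show ?thesis by (intro exI[of _ "[]"]) (simp add: mtrace_def)
  next
    case 2
    interpret I: irreducible_rep G n \<rho> using 2 by (rule irreducible_repI)
    show ?thesis
      by (rule exI[of _ "[rep_character G n \<rho>]"]) (simp add: I.character_in_Irr R.character_eq_mtrace)
  next
    case (3 W)
    obtain k l U S U' S' where U: "U \<in> carrier_mat n k" and S: "S \<in> carrier_mat k n"
      and U': "U' \<in> carrier_mat n l" and S': "S' \<in> carrier_mat l n"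
      and SU: "S * U = 1\<^sub>m k" and S'U': "S' * U' = 1\<^sub>m l" and S'U: "S' * U = 0\<^sub>m l k"
      and one: "U * S + U' * S' = 1\<^sub>m n" and kl: "k < n" "l < n"
      and UW: "\<And>x. x \<in> carrier_vec k \<Longrightarrow> U *\<^sub>v x \<in> W" and USw: "\<And>w. w \<in> W \<Longrightarrow> U *\<^sub>v (S *\<^sub>v w) = w"
      by (rule vsubspace_splitting[OF 3(2,4,5)]) (rule that)
    note d [simp] = carrier_matD[OF U] carrier_matD[OF S] carrier_matD[OF U'] carrier_matD[OF S']
    have US: "U * S \<in> carrier_mat n n" and US': "U' * S' \<in> carrier_mat n n" using U S U' S' by auto
    have e1: "1\<^sub>m n - U * S = U' * S'" and e2: "1\<^sub>m n - U' * S' = U * S"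
      unfolding one[symmetric] using US US' by (auto intro!: eq_matI simp del: index_mult_mat(1))
    \<comment> \<open>\<open>\<rho> g\<close> maps \<open>W\<close> into itself, so \<open>U * S\<close> fixes its values on \<open>W\<close> and \<open>S'\<close> annihilates them.\<close>
    have USg: "U * (S * (\<rho> g * U)) = \<rho> g * U" if g: "g \<in> carrier G" for g
    proof (rule mat_eqI_mult_vec[of _ n k])
      fix v :: "complex vec" assume v: "v \<in> carrier_vec k"
      have "U *\<^sub>v (S *\<^sub>v (\<rho> g *\<^sub>v (U *\<^sub>v v))) = \<rho> g *\<^sub>v (U *\<^sub>v v)"
        using v by (intro USw 3(3)[OF g] UW)
      then show "U * (S * (\<rho> g * U)) *\<^sub>v v = \<rho> g * U *\<^sub>v v"
        using v g by (simp add: assoc_mult_mat_vec_dim)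
    qed (use g in \<open>auto intro!: carrier_matI\<close>)
    have S'g: "S' * (\<rho> g * U) = 0\<^sub>m l k" if g: "g \<in> carrier G" for g
    proof -
      have "S' * (\<rho> g * U) = (S' * U) * (S * (\<rho> g * U))"
        using g by (simp add: assoc_mult_mat_dim USg)
      also have "\<dots> = 0\<^sub>m l k"
        using g by (auto simp: S'U intro!: left_mult_zero_mat carrier_matI)
      finally show ?thesis .
    qed
    have A: "representation G k (\<lambda>g. S * \<rho> g * U)"
    proof (rule R.subrepresentation[OF U S SU])
      fix g h assume g: "g \<in> carrier G" and h: "h \<in> carrier G"
      have "S * \<rho> g * (1\<^sub>m n - U * S) * \<rho> h * U = S * \<rho> g * U' * (S' * (\<rho> h * U))"
        using g h by (simp add: e1 assoc_mult_mat_dim)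
      also have "\<dots> = 0\<^sub>m k k"
        unfolding S'g[OF h] using g by (intro right_mult_zero_mat carrier_matI) auto
      finally show "S * \<rho> g * (1\<^sub>m n - U * S) * \<rho> h * U = 0\<^sub>m k k" .
    qed
    have D: "representation G l (\<lambda>g. S' * \<rho> g * U')"
    proof (rule R.subrepresentation[OF U' S' S'U'])
      fix g h assume g: "g \<in> carrier G" and h: "h \<in> carrier G"
      have "S' * \<rho> g * (1\<^sub>m n - U' * S') * \<rho> h * U' = S' * (\<rho> g * U) * (S * \<rho> h * U')"
        using g h by (simp add: e2 assoc_mult_mat_dim)
      also have "\<dots> = 0\<^sub>m l l"
        unfolding S'g[OF g] using h by (intro left_mult_zero_mat carrier_matI) auto
      finally show "S' * \<rho> g * (1\<^sub>m n - U' * S') * \<rho> h * U' = 0\<^sub>m l l" .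
    qed
    obtain xs where xs: "set xs \<subseteq> Irr G" "\<And>g. g \<in> carrier G \<Longrightarrow> mtrace (S * \<rho> g * U) = (\<Sum>\<chi>\<leftarrow>xs. \<chi> g)"
      using less.IH[OF kl(1) A] by auto
    obtain ys where ys: "set ys \<subseteq> Irr G" "\<And>g. g \<in> carrier G \<Longrightarrow> mtrace (S' * \<rho> g * U') = (\<Sum>\<chi>\<leftarrow>ys. \<chi> g)"
      using less.IH[OF kl(2) D] by auto
    have "mtrace (\<rho> g) = (\<Sum>\<chi>\<leftarrow>xs @ ys. \<chi> g)" if g: "g \<in> carrier G" for g
    proof -
      have "\<rho> g = \<rho> g * (U * S + U' * S')" using R.closed[OF g] by (simp add: one)
      also have "\<dots> = \<rho> g * U * S + \<rho> g * U' * S'"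
        using g by (simp add: mult_add_distrib_mat[OF R.closed[OF g] US US'] assoc_mult_mat_dim)
      finally have "mtrace (\<rho> g) = mtrace (\<rho> g * U * S) + mtrace (\<rho> g * U' * S')"
        using g by (metis (no_types, lifting) mtrace_add mult_carrier_mat R.closed U S U' S')
      also have "mtrace (\<rho> g * U * S) = mtrace (S * (\<rho> g * U))"
        using g by (intro mtrace_comm[of _ n k]) (auto intro!: carrier_matI)
      also have "mtrace (\<rho> g * U' * S') = mtrace (S' * (\<rho> g * U'))"
        using g by (intro mtrace_comm[of _ n l]) (auto intro!: carrier_matI)
      finally show ?thesis using xs(2)[OF g] ys(2)[OF g] g by (simp add: assoc_mult_mat_dim)
    qed
    then show ?thesis using xs(1) ys(1) by (intro exI[of _ "xs @ ys"]) auto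
  qed
qed

section \<open>Irreducibility and equality of irreducible characters\<close>

text \<open>
  If the matrices of the representation span all matrix units, an invariant subspace that contains a
  vector with a nonzero coordinate contains every unit vector.
\<close>

lemma (in representation) irreducible_if_spanning:
  assumes n: "n > 0"
    and span: "\<And>i j. i < n \<Longrightarrow> j < n \<Longrightarrow>
      \<exists>c. \<forall>a<n. \<forall>b<n. (\<Sum>g\<in>carrier G. c g * \<rho> g $$ (a, b)) = (if a = i \<and> b = j then 1 else 0)"
  shows "irreducible_representation G n \<rho>"
  unfolding irreducible_representation_def
proof (intro conjI allI impI)
  fix W assume W: "vsubspace n W" and inv: "\<forall>g\<in>carrier G. \<forall>w\<in>W. \<rho> g *\<^sub>v w \<in> W"
  have "W = carrier_vec n" if W0: "W \<noteq> {0\<^sub>v n}"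
  proof -
    obtain w where w: "w \<in> W" "w \<noteq> 0\<^sub>v n" using W0 W by (auto simp: vsubspace_iff)
    have wc: "w \<in> carrier_vec n" using w W by (auto simp: vsubspace_iff)
    obtain j where j: "j < n" "w $ j \<noteq> 0" using w(2) wc by (metis carrier_vecD eq_vecI index_zero_vec)
    have unit: "unit_vec n i \<in> W" if i: "i < n" for i
    proof -
      obtain c where c: "\<And>a b. a < n \<Longrightarrow> b < n \<Longrightarrow>
          (\<Sum>g\<in>carrier G. c g * \<rho> g $$ (a, b)) = (if a = i \<and> b = j then 1 else 0)"
        using span[OF i j(1)] by blast
      define u where "u = vec n (\<lambda>a. \<Sum>g\<in>carrier G. c g * (\<rho> g *\<^sub>v w) $ a)"
      have uW: "u \<in> W" unfolding u_def using inv w by (intro vsubspace_sum[OF W]) auto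
      have "u = w $ j \<cdot>\<^sub>v unit_vec n i"
      proof (rule eq_vecI)
        fix a assume "a < dim_vec (w $ j \<cdot>\<^sub>v unit_vec n i)"
        then have a: "a < n" by simp
        have "u $ a = (\<Sum>g\<in>carrier G. c g * (\<Sum>b<n. \<rho> g $$ (a, b) * w $ b))"
          using a by (simp add: u_def index_mult_mat_vec_sum[OF closed wc] del: index_mult_mat_vec)
        also have "\<dots> = (\<Sum>b<n. (\<Sum>g\<in>carrier G. c g * \<rho> g $$ (a, b)) * w $ b)"
          by (simp add: sum_distrib_left sum_distrib_right mult.assoc) (rule sum.swap)
        also have "\<dots> = (\<Sum>b<n. if b = j then (if a = i then w $ j else 0) else 0)"
          using a by (intro sum.cong refl) (auto simp: c)
        also have "\<dots> = (w $ j \<cdot>\<^sub>v unit_vec n i) $ a" using a i j by simp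
        finally show "u $ a = (w $ j \<cdot>\<^sub>v unit_vec n i) $ a" .
      qed (simp add: u_def)
      then have "unit_vec n i = (1 / w $ j) \<cdot>\<^sub>v u" using j by (auto intro!: eq_vecI)
      then show ?thesis using uW W by (simp add: vsubspace_iff)
    qed
    have "v \<in> W" if v: "v \<in> carrier_vec n" for v
    proof -
      have "v = 1\<^sub>m n *\<^sub>v v" using v by simp
      also have "\<dots> \<in> W"
        using v unit by (intro vsubspace_mult_vec[OF W, of _ n]) auto
      finally show ?thesis .
    qed
    then show ?thesis using W by (auto simp: vsubspace_iff)
  qed
  then show "W = {0\<^sub>v n} \<or> W = carrier_vec n" by blast
qed (use n rep in auto)

text \<open>
  With \<open>\<sigma> (inv g)\<close> in place of a complex conjugate, the pairing is a sum of entries of averaged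
  matrices, which are intertwiners between \<open>\<rho>\<close> and \<open>\<sigma>\<close>.  So a nonzero value yields a nonzero
  intertwiner.
\<close>

lemma irreducible_characters_eq:
  assumes "irreducible_rep G n \<rho>" "irreducible_rep G m \<sigma>"
    and ne: "(\<Sum>g\<in>carrier G. rep_character G n \<rho> g * rep_character G m \<sigma> (inv\<^bsub>G\<^esub> g)) \<noteq> 0"
  shows "rep_character G n \<rho> = rep_character G m \<sigma>"
proof -
  interpret R: irreducible_rep G n \<rho> by fact
  interpret S: irreducible_rep G m \<sigma> by fact
  define avg where "avg i j = mat_sum n m (carrier G) (\<lambda>g. \<rho> g * matrix_unit n m i j * \<sigma> (inv\<^bsub>G\<^esub> g))" for i j
  have entry: "avg i j $$ (a, b) = (\<Sum>g\<in>carrier G. \<rho> g $$ (a, i) * \<sigma> (inv\<^bsub>G\<^esub> g) $$ (j, b))"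
    if "i < n" "a < n" "j < m" "b < m" for i j a b
    using that by (simp add: avg_def matrix_unit_sandwich[of _ n n _ m m] del: index_mult_mat(1))
  have "(\<Sum>g\<in>carrier G. rep_character G n \<rho> g * rep_character G m \<sigma> (inv\<^bsub>G\<^esub> g)) =
      (\<Sum>g\<in>carrier G. \<Sum>i<n. \<Sum>j<m. \<rho> g $$ (i, i) * \<sigma> (inv\<^bsub>G\<^esub> g) $$ (j, j))"
    by (simp add: rep_character_def sum_product)
  also have "\<dots> = (\<Sum>i<n. \<Sum>j<m. avg i j $$ (i, j))"
    by (subst sum.swap, intro sum.cong refl, subst sum.swap) (simp add: entry)
  \<comment> \<open>The pairing is a sum of entries of averaged matrix units, so one of these averages is nonzero.\<close>
  finally obtain i j where ij: "i < n" "j < m" "avg i j $$ (i, j) \<noteq> 0"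
    using ne by (metis (no_types, lifting) lessThan_iff sum.neutral)
  define T where "T = avg i j"
  have T: "T \<in> carrier_mat n m" by (simp add: T_def avg_def)
  have Tg: "\<rho> g * T = T * \<sigma> g" if "g \<in> carrier G" for g
    unfolding T_def avg_def using that R.representation_axioms S.representation_axioms
    by (intro average_intertwines) auto
  \<comment> \<open>The intertwiner \<open>V\<close> in the other direction is chosen such that the trace of \<open>T * V\<close> is a multiple
    of the nonzero entry of \<open>T\<close>; then \<open>T\<close> and \<open>V\<close> are inverse to each other up to a scalar.\<close>
  define V where "V = mat_sum m n (carrier G) (\<lambda>g. \<sigma> g * matrix_unit m n j i * \<rho> (inv\<^bsub>G\<^esub> g))"
  have V: "V \<in> carrier_mat m n" by (simp add: V_def)
  have Vg: "\<sigma> g * V = V * \<rho> g" if "g \<in> carrier G" for g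
    unfolding V_def using that R.representation_axioms S.representation_axioms
    by (intro average_intertwines) auto
  note d [simp] = carrier_matD[OF T] carrier_matD[OF V] carrier_matD[OF matrix_unit_carrier]
  have "T * V * \<rho> g = \<rho> g * (T * V)" if g: "g \<in> carrier G" for g
  proof -
    have "T * V * \<rho> g = T * (\<sigma> g * V)" using g Vg by (simp add: assoc_mult_mat_dim)
    also have "\<dots> = (\<rho> g * T) * V" using g Tg by (simp add: assoc_mult_mat_dim)
    finally show ?thesis using g by (simp add: assoc_mult_mat_dim)
  qed
  then obtain c where TV: "T * V = c \<cdot>\<^sub>m 1\<^sub>m n"
    using R.schur_scalar[of "T * V"] T V by (metis mult_carrier_mat)
  have "V * T * \<sigma> g = \<sigma> g * (V * T)" if g: "g \<in> carrier G" for g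
  proof -
    have "V * T * \<sigma> g = V * (\<rho> g * T)" using g Tg by (simp add: assoc_mult_mat_dim)
    also have "\<dots> = (\<sigma> g * V) * T" using g Vg by (simp add: assoc_mult_mat_dim)
    finally show ?thesis using g by (simp add: assoc_mult_mat_dim)
  qed
  then obtain d where VT: "V * T = d \<cdot>\<^sub>m 1\<^sub>m m"
    using S.schur_scalar[of "V * T"] T V by (metis mult_carrier_mat)
  have "mtrace (T * V) = (\<Sum>g\<in>carrier G. mtrace (T * (\<sigma> g * matrix_unit m n j i * \<rho> (inv\<^bsub>G\<^esub> g))))"
    unfolding V_def using T
    by (subst mult_mat_sum[OF T]) (auto intro!: mtrace_mat_sum carrier_matI)
  also have "\<dots> = (\<Sum>g\<in>carrier G. mtrace (T * matrix_unit m n j i))"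
  proof (rule sum.cong[OF refl])
    fix g assume g: "g \<in> carrier G"
    have "T * (\<sigma> g * matrix_unit m n j i * \<rho> (inv\<^bsub>G\<^esub> g)) = T * \<sigma> g * (matrix_unit m n j i * \<rho> (inv\<^bsub>G\<^esub> g))"
      using g by (simp add: assoc_mult_mat_dim)
    also have "\<dots> = \<rho> g * (T * (matrix_unit m n j i * \<rho> (inv\<^bsub>G\<^esub> g)))"
      using g by (simp add: Tg[symmetric] assoc_mult_mat_dim)
    finally have "mtrace (T * (\<sigma> g * matrix_unit m n j i * \<rho> (inv\<^bsub>G\<^esub> g))) =
        mtrace (\<rho> g * (T * (matrix_unit m n j i * \<rho> (inv\<^bsub>G\<^esub> g))))" by simp
    also have "\<dots> = mtrace (T * (matrix_unit m n j i * \<rho> (inv\<^bsub>G\<^esub> g)) * \<rho> g)"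
      using g by (intro mtrace_comm[of _ n n]) (auto intro!: carrier_matI)
    also have "T * (matrix_unit m n j i * \<rho> (inv\<^bsub>G\<^esub> g)) * \<rho> g = T * matrix_unit m n j i"
      using g by (simp add: assoc_mult_mat_dim R.mult_inv right_mult_one_mat')
    finally show "mtrace (T * (\<sigma> g * matrix_unit m n j i * \<rho> (inv\<^bsub>G\<^esub> g))) = mtrace (T * matrix_unit m n j i)" .
  qed
  also have "mtrace (T * matrix_unit m n j i) = T $$ (i, j)"
  proof -
    have "mtrace (T * matrix_unit m n j i) = (\<Sum>a<n. (T * matrix_unit m n j i * 1\<^sub>m n) $$ (a, a))"
      by (simp add: mtrace_def right_mult_one_mat' del: index_mult_mat(1))
    also have "\<dots> = (\<Sum>a<n. if a = i then T $$ (i, j) else 0)"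
      using ij by (intro sum.cong refl) (auto simp: matrix_unit_sandwich[OF T one_carrier_mat] simp del: index_mult_mat right_mult_one_mat)
    finally show ?thesis using ij by simp
  qed
  finally have trTV: "mtrace (T * V) \<noteq> 0" using ij R.one_closed by (auto simp: T_def)
  then have c: "c \<noteq> 0" by (auto simp: TV mtrace_def)
  have "c \<cdot>\<^sub>m T = d \<cdot>\<^sub>m T"
  proof -
    have "c \<cdot>\<^sub>m T = (c \<cdot>\<^sub>m 1\<^sub>m n) * T" using T by (simp add: mult_smult_assoc_mat[OF one_carrier_mat T])
    also have "\<dots> = T * (d \<cdot>\<^sub>m 1\<^sub>m m)" by (simp add: TV[symmetric] VT[symmetric] assoc_mult_mat_dim)
    also have "\<dots> = d \<cdot>\<^sub>m T" using T by (simp add: mult_smult_distrib[OF T])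
    finally show ?thesis .
  qed
  then have "(c \<cdot>\<^sub>m T) $$ (i, j) = (d \<cdot>\<^sub>m T) $$ (i, j)" by simp
  then have cd: "c = d" using ij T by (simp add: T_def[symmetric])
  have "rep_character G n \<rho> g = rep_character G m \<sigma> g" if g: "g \<in> carrier G" for g
  proof -
    have "c * mtrace (\<rho> g) = mtrace (\<rho> g * (T * V))"
      using R.closed[OF g] by (simp add: TV mtrace_def sum_distrib_left mult_smult_distrib[OF R.closed[OF g]])
    also have "\<rho> g * (T * V) = T * (\<sigma> g * V)"
      using g by (simp add: assoc_mult_mat_dim[symmetric] Tg)
    also have "mtrace (T * (\<sigma> g * V)) = mtrace (\<sigma> g * V * T)"
      using g by (intro mtrace_comm[of _ n m]) (auto intro!: carrier_matI)
    also have "\<sigma> g * V * T = \<sigma> g * (d \<cdot>\<^sub>m 1\<^sub>m m)"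
      using g by (simp add: assoc_mult_mat_dim VT[symmetric])
    also have "mtrace \<dots> = d * mtrace (\<sigma> g)"
      using S.closed[OF g] by (simp add: mtrace_def sum_distrib_left mult_smult_distrib[OF S.closed[OF g]])
    finally show ?thesis using c cd g by (simp add: R.character_eq_mtrace S.character_eq_mtrace)
  qed
  then show ?thesis by (auto simp: rep_character_def restrict_def fun_eq_iff)
qed

section \<open>Outer tensor products\<close>

text \<open>
  The Kronecker product, with the index pair \<open>(a, b)\<close> encoded as \<open>a * m + b\<close>.
\<close>

definition kron :: "complex mat \<Rightarrow> complex mat \<Rightarrow> complex mat" where
  "kron A B = mat (dim_row A * dim_row B) (dim_col A * dim_col B)
     (\<lambda>(i, j). A $$ (i div dim_row B, j div dim_col B) * B $$ (i mod dim_row B, j mod dim_col B))"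

lemma kron_dim [simp]: "dim_row (kron A B) = dim_row A * dim_row B" "dim_col (kron A B) = dim_col A * dim_col B"
  by (simp_all add: kron_def)

lemma div_mod_less: "i < n * m \<Longrightarrow> i div m < n \<and> i mod m < m" for i n m :: nat
  by (cases "m = 0") (auto simp: less_mult_imp_div_less)

lemma sum_div_mod:
  "(\<Sum>k<n * m. f (k div m) (k mod m)) = (\<Sum>a<n. \<Sum>b<m. f a b)" for n m :: nat
proof -
  have "a * m + b < n * m" if "a < n" "b < m" for a b
  proof -
    have "a * m + b < Suc a * m" using that by simp
    also have "\<dots> \<le> n * m" using that by (intro mult_le_mono1) simp
    finally show ?thesis .
  qed
  then have "(\<Sum>k<n * m. f (k div m) (k mod m)) = (\<Sum>(a, b)\<in>{..<n} \<times> {..<m}. f a b)"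
    by (intro sum.reindex_bij_witness[of _ "\<lambda>(a, b). a * m + b" "\<lambda>k. (k div m, k mod m)"])
      (use div_mod_less in auto)
  then show ?thesis by (simp add: sum.cartesian_product)
qed

lemma kron_mult:
  assumes "dim_col A = dim_row C" "dim_col B = dim_row D"
  shows "kron A B * kron C D = kron (A * C) (B * D)"
proof (rule eq_matI)
  fix i j assume "i < dim_row (kron (A * C) (B * D))" "j < dim_col (kron (A * C) (B * D))"
  then have i: "i < dim_row A * dim_row B" and j: "j < dim_col C * dim_col D" by simp_all
  note i' = div_mod_less[OF i] and j' = div_mod_less[OF j]
  define ia ib ja jb where
    d: "ia = i div dim_row B" "ib = i mod dim_row B" "ja = j div dim_col D" "jb = j mod dim_col D"
  have "(kron A B * kron C D) $$ (i, j) =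
      (\<Sum>k<dim_row C * dim_row D. kron A B $$ (i, k) * kron C D $$ (k, j))"
    using i j assms by (intro index_mult_mat_sum) simp_all
  also have "\<dots> = (\<Sum>k<dim_row C * dim_row D. (A $$ (ia, k div dim_row D) * C $$ (k div dim_row D, ja)) *
      (B $$ (ib, k mod dim_row D) * D $$ (k mod dim_row D, jb)))"
    using i j assms by (intro sum.cong refl) (simp add: kron_def d)
  also have "\<dots> = (\<Sum>a<dim_row C. \<Sum>b<dim_row D. (A $$ (ia, a) * C $$ (a, ja)) * (B $$ (ib, b) * D $$ (b, jb)))"
    by (rule sum_div_mod)
  also have "\<dots> = (A * C) $$ (ia, ja) * (B * D) $$ (ib, jb)"
    using i' j' assms
    by (simp add: index_mult_mat_sum[of A "dim_row A" "dim_row C" C "dim_col C"]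
        index_mult_mat_sum[of B "dim_row B" "dim_row D" D "dim_col D"] sum_product d del: index_mult_mat(1))
  also have "\<dots> = kron (A * C) (B * D) $$ (i, j)"
    using i j by (simp add: kron_def d del: index_mult_mat(1))
  finally show "(kron A B * kron C D) $$ (i, j) = kron (A * C) (B * D) $$ (i, j)" .
qed simp_all

lemma kron_one: "kron (1\<^sub>m n) (1\<^sub>m m) = 1\<^sub>m (n * m)"
proof (rule eq_matI)
  fix i j assume "i < dim_row (1\<^sub>m (n * m) :: complex mat)" "j < dim_col (1\<^sub>m (n * m) :: complex mat)"
  then show "kron (1\<^sub>m n) (1\<^sub>m m) $$ (i, j) = 1\<^sub>m (n * m) $$ (i, j)"
    using div_mod_less[of i n m] div_mod_less[of j n m]
    by (auto simp: kron_def) (metis div_mult_mod_eq)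
qed simp_all

lemma mtrace_kron:
  assumes "A \<in> carrier_mat n n" "B \<in> carrier_mat m m"
  shows "mtrace (kron A B) = mtrace A * mtrace B"
proof -
  have "mtrace (kron A B) = (\<Sum>k<n * m. A $$ (k div m, k div m) * B $$ (k mod m, k mod m))"
    using assms by (simp add: mtrace_def kron_def)
  also have "\<dots> = (\<Sum>a<n. \<Sum>b<m. A $$ (a, a) * B $$ (b, b))" by (rule sum_div_mod)
  finally show ?thesis using assms by (simp add: mtrace_def sum_product)
qed

lemma finite_group_DirProd:
  assumes "finite_group G" "finite_group H" shows "finite_group (G \<times>\<times> H)"
  using assms DirProd_group[of G H] by (simp add: finite_group_def finite_group_axioms_def)

lemma representation_outer:
  assumes "representation G n \<rho>" "representation H m \<sigma>"
  shows "representation (G \<times>\<times> H) (n * m) (\<lambda>x. kron (\<rho> (fst x)) (\<sigma> (snd x)))"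
proof -
  interpret R: representation G n \<rho> by fact
  interpret S: representation H m \<sigma> by fact
  interpret P: finite_group "G \<times>\<times> H"
    by (rule finite_group_DirProd) (rule R.finite_group_axioms S.finite_group_axioms)+
  show ?thesis
    by (rule P.representationI) (auto simp: R.mult S.mult kron_mult kron_one)
qed

definition outer_character ::
    "('a, 'm) monoid_scheme \<Rightarrow> ('b, 'n) monoid_scheme \<Rightarrow> ('a \<Rightarrow> complex) \<Rightarrow> ('b \<Rightarrow> complex) \<Rightarrow> 'a \<times> 'b \<Rightarrow> complex" where
  "outer_character G H \<chi> \<psi> = (\<lambda>x\<in>carrier G \<times> carrier H. \<chi> (fst x) * \<psi> (snd x))"

text \<open>
  By the orthogonality relations each matrix unit is a linear combination of the matrices of an
  irreducible representation.  Kronecker products of matrix units are matrix units, so the outer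
  tensor product inherits this property, which implies irreducibility.
\<close>

lemma irreducible_outer:
  assumes "irreducible_rep G n \<rho>" "irreducible_rep H m \<sigma>"
  shows "irreducible_representation (G \<times>\<times> H) (n * m) (\<lambda>x. kron (\<rho> (fst x)) (\<sigma> (snd x)))"
proof -
  interpret R: irreducible_rep G n \<rho> by fact
  interpret S: irreducible_rep H m \<sigma> by fact
  interpret P: representation "G \<times>\<times> H" "n * m" "\<lambda>x. kron (\<rho> (fst x)) (\<sigma> (snd x))"
    by (rule representation_outer) (rule R.representation_axioms S.representation_axioms)+
  show ?thesis
  proof (rule P.irreducible_if_spanning)
    show "0 < n * m" using R.degree_pos S.degree_pos by simp
    fix i j assume i: "i < n * m" and j: "j < n * m"
    \<comment> \<open>\<open>u\<close> normalises the two orthogonality relations to value 1.\<close>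
    define u where "u = of_nat n / of_nat (card (carrier G)) * (of_nat m / of_nat (card (carrier H)) :: complex)"
    define c where "c x = u * (\<rho> (inv\<^bsub>G\<^esub> fst x) $$ (j div m, i div m) * \<sigma> (inv\<^bsub>H\<^esub> snd x) $$ (j mod m, i mod m))" for x
    have "(\<Sum>x\<in>carrier (G \<times>\<times> H). c x * kron (\<rho> (fst x)) (\<sigma> (snd x)) $$ (a, b)) = (if a = i \<and> b = j then 1 else 0)"
      if a: "a < n * m" and b: "b < n * m" for a b
    proof -
      note lt = div_mod_less[OF i] div_mod_less[OF j] div_mod_less[OF a] div_mod_less[OF b]
      have "(\<Sum>x\<in>carrier (G \<times>\<times> H). c x * kron (\<rho> (fst x)) (\<sigma> (snd x)) $$ (a, b)) =
          (\<Sum>x\<in>carrier G \<times> carrier H. u * ((\<rho> (fst x) $$ (a div m, b div m) * \<rho> (inv\<^bsub>G\<^esub> fst x) $$ (j div m, i div m)) *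
            (\<sigma> (snd x) $$ (a mod m, b mod m) * \<sigma> (inv\<^bsub>H\<^esub> snd x) $$ (j mod m, i mod m))))"
        using a b by (intro sum.cong) (auto simp: c_def kron_def)
      also have "\<dots> = u * ((\<Sum>g\<in>carrier G. \<rho> g $$ (a div m, b div m) * \<rho> (inv\<^bsub>G\<^esub> g) $$ (j div m, i div m)) *
          (\<Sum>h\<in>carrier H. \<sigma> h $$ (a mod m, b mod m) * \<sigma> (inv\<^bsub>H\<^esub> h) $$ (j mod m, i mod m)))"
        unfolding sum_product sum.cartesian_product by (simp add: sum_distrib_left case_prod_beta)
      also have "\<dots> = (if (a div m = i div m \<and> b div m = j div m) \<and> (a mod m = i mod m \<and> b mod m = j mod m) then 1 else 0)"
        using lt R.schur_orthogonality[of "a div m" "i div m" "b div m" "j div m"]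
          S.schur_orthogonality[of "a mod m" "i mod m" "b mod m" "j mod m"] R.card_pos S.card_pos R.degree_pos S.degree_pos
        by (auto simp: u_def)
      also have "\<dots> = (if a = i \<and> b = j then 1 else 0)"
        by (metis div_mult_mod_eq)
      finally show ?thesis .
    qed
    then show "\<exists>c. \<forall>a<n * m. \<forall>b<n * m.
        (\<Sum>x\<in>carrier (G \<times>\<times> H). c x * kron (\<rho> (fst x)) (\<sigma> (snd x)) $$ (a, b)) = (if a = i \<and> b = j then 1 else 0)"
      by blast
  qed
qed

lemma outer_character_in_Irr:
  assumes G: "finite_group G" and H: "finite_group H" and "\<chi> \<in> Irr G" "\<psi> \<in> Irr H"
  shows "outer_character G H \<chi> \<psi> \<in> Irr (G \<times>\<times> H)"
proof -
  obtain n \<rho> where \<rho>: "irreducible_rep G n \<rho>" "\<chi> = rep_character G n \<rho>"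
    using finite_group.IrrE[OF G] assms by metis
  obtain m \<sigma> where \<sigma>: "irreducible_rep H m \<sigma>" "\<psi> = rep_character H m \<sigma>"
    using finite_group.IrrE[OF H] assms by metis
  interpret R: irreducible_rep G n \<rho> by fact
  interpret S: irreducible_rep H m \<sigma> by fact
  interpret P: representation "G \<times>\<times> H" "n * m" "\<lambda>x. kron (\<rho> (fst x)) (\<sigma> (snd x))"
    by (rule representation_outer) (rule R.representation_axioms S.representation_axioms)+
  have "rep_character (G \<times>\<times> H) (n * m) (\<lambda>x. kron (\<rho> (fst x)) (\<sigma> (snd x))) x = outer_character G H \<chi> \<psi> x" for x
  proof (cases "x \<in> carrier G \<times> carrier H")
    case True
    then show ?thesis
      using P.character_eq_mtrace[of x]
      by (auto simp: outer_character_def \<rho> \<sigma> R.character_eq_mtrace S.character_eq_mtrace mtrace_kron[of _ n _ m])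
  next
    case False
    then show ?thesis by (simp add: rep_character_def outer_character_def restrict_def)
  qed
  then have "outer_character G H \<chi> \<psi> = rep_character (G \<times>\<times> H) (n * m) (\<lambda>x. kron (\<rho> (fst x)) (\<sigma> (snd x)))" by auto
  then show ?thesis using irreducible_outer[OF \<rho>(1) \<sigma>(1)] by (auto simp: Irr_def)
qed

section \<open>Irreducible characters of direct products\<close>

text \<open>
  The function on the right is the character of the regular representation: left multiplication by
  \<open>g \<noteq> \<one>\<close> fixes no element of the group.
\<close>

lemma (in finite_group) regular_character_decomposition:
  "\<exists>xs. set xs \<subseteq> Irr G \<and>
     (\<forall>g\<in>carrier G. (\<Sum>\<chi>\<leftarrow>xs. \<chi> g) = (if g = \<one> then of_nat (card (carrier G)) else 0))"
proof -
  define N where "N = card (carrier G)"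
  obtain f where f: "bij_betw f {..<N} (carrier G)"
    using ex_bij_betw_nat_finite[OF fin] by (auto simp: atLeast0LessThan N_def)
  have fG [simp]: "f i \<in> carrier G" if "i < N" for i using f that by (auto simp: bij_betw_def)
  have f_inj: "f i = f j \<longleftrightarrow> i = j" if "i < N" "j < N" for i j
    using f that by (auto simp: bij_betw_def inj_on_def)
  define \<rho> where "\<rho> g = mat N N (\<lambda>(i, j). if f i = g \<otimes> f j then 1 else 0 :: complex)" for g
  interpret R: representation G N \<rho>
  proof (rule representationI)
    show "\<rho> g \<in> carrier_mat N N" for g by (simp add: \<rho>_def)
    show "\<rho> \<one> = 1\<^sub>m N" by (rule eq_matI) (auto simp: \<rho>_def f_inj)
    fix g h assume g: "g \<in> carrier G" and h: "h \<in> carrier G"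
    show "\<rho> (g \<otimes> h) = \<rho> g * \<rho> h"
    proof (rule eq_matI)
      fix i j assume "i < dim_row (\<rho> g * \<rho> h)" "j < dim_col (\<rho> g * \<rho> h)"
      then have i: "i < N" and j: "j < N" by (auto simp: \<rho>_def)
      obtain l where l: "l < N" "f l = h \<otimes> f j"
        using f h j by (metis bij_betw_iff_bijections fG lessThan_iff m_closed)
      have "(\<rho> g * \<rho> h) $$ (i, j) = (\<Sum>k<N. \<rho> g $$ (i, k) * \<rho> h $$ (k, j))"
        using i j by (intro index_mult_mat_sum) (auto simp: \<rho>_def)
      also have "\<dots> = (\<Sum>k<N. if k = l then (if f i = g \<otimes> f l then 1 else 0) else 0)"
        using i j l by (intro sum.cong refl) (auto simp: \<rho>_def f_inj simp flip: l(2))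
      also have "\<dots> = (if f i = g \<otimes> f l then 1 else 0)" using l by simp
      also have "\<dots> = \<rho> (g \<otimes> h) $$ (i, j)" using i j l g h by (simp add: \<rho>_def m_assoc)
      finally show "\<rho> (g \<otimes> h) $$ (i, j) = (\<rho> g * \<rho> h) $$ (i, j)" by simp
    qed (auto simp: \<rho>_def)
  qed
  have "mtrace (\<rho> g) = (if g = \<one> then of_nat N else 0)" if g: "g \<in> carrier G" for g
  proof (cases "g = \<one>")
    case False
    have "f i \<noteq> g \<otimes> f i" if i: "i < N" for i
      using False g fG[OF i] r_cancel_one' by metis
    then show ?thesis using False by (auto simp: mtrace_def \<rho>_def intro!: sum.neutral)
  qed simp
  then show ?thesis using R.character_decomposition by (metis N_def)
qed

lemma sum_list_pairing_nonzero:
  assumes "(\<Sum>p\<in>X. F p * (\<Sum>\<chi>\<leftarrow>xs. \<chi> (k p))) \<noteq> (0 :: complex)"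
  obtains \<chi> where "\<chi> \<in> set xs" "(\<Sum>p\<in>X. F p * \<chi> (k p)) \<noteq> 0"
proof -
  have "\<exists>\<chi>\<in>set xs. (\<Sum>p\<in>X. F p * \<chi> (k p)) \<noteq> 0"
    using assms
  proof (induction xs)
    case (Cons \<chi> xs)
    then have "(\<Sum>p\<in>X. F p * \<chi> (k p)) + (\<Sum>p\<in>X. F p * (\<Sum>\<chi>\<leftarrow>xs. \<chi> (k p))) \<noteq> 0"
      by (simp add: distrib_left sum.distrib)
    then show ?case using Cons.IH by fastforce
  qed simp
  then show ?thesis using that by blast
qed

text \<open>
  The pairing of \<open>\<theta>\<close> with the product of the two regular characters is \<open>\<theta>(1) |G| |H| \<noteq> 0\<close>.
  Expanding these characters into irreducible ones gives \<open>\<chi>\<close> and \<open>\<psi>\<close> whose outer product pairs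
  nontrivially with \<open>\<theta>\<close>.  As this product is irreducible, it equals \<open>\<theta>\<close>.
\<close>

lemma Irr_DirProdE:
  assumes G: "finite_group G" and H: "finite_group H" and \<theta>: "\<theta> \<in> Irr (G \<times>\<times> H)"
  obtains \<chi> \<psi> where "\<chi> \<in> Irr G" "\<psi> \<in> Irr H" "\<theta> = outer_character G H \<chi> \<psi>"
proof -
  interpret G: finite_group G by fact
  interpret H: finite_group H by fact
  interpret P: finite_group "G \<times>\<times> H" by (rule finite_group_DirProd[OF G H])
  have one: "\<one>\<^bsub>G \<times>\<times> H\<^esub> = (\<one>\<^bsub>G\<^esub>, \<one>\<^bsub>H\<^esub>)" by (simp add: DirProd_def)
  obtain n \<tau> where \<tau>: "irreducible_rep (G \<times>\<times> H) n \<tau>" "\<theta> = rep_character (G \<times>\<times> H) n \<tau>"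
    using P.IrrE[OF \<theta>] by metis
  interpret T: irreducible_rep "G \<times>\<times> H" n \<tau> by fact
  obtain xs where xs: "set xs \<subseteq> Irr G"
    "\<And>g. g \<in> carrier G \<Longrightarrow> (\<Sum>\<chi>\<leftarrow>xs. \<chi> g) = (if g = \<one>\<^bsub>G\<^esub> then of_nat (card (carrier G)) else 0)"
    using G.regular_character_decomposition by blast
  obtain ys where ys: "set ys \<subseteq> Irr H"
    "\<And>h. h \<in> carrier H \<Longrightarrow> (\<Sum>\<psi>\<leftarrow>ys. \<psi> h) = (if h = \<one>\<^bsub>H\<^esub> then of_nat (card (carrier H)) else 0)"
    using H.regular_character_decomposition by blast
  let ?C = "carrier G \<times> carrier H"
  have "(\<Sum>x\<in>?C. (\<theta> x * (\<Sum>\<chi>\<leftarrow>xs. \<chi> (inv\<^bsub>G\<^esub> fst x))) * (\<Sum>\<psi>\<leftarrow>ys. \<psi> (inv\<^bsub>H\<^esub> snd x))) =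
      (\<Sum>x\<in>?C. if x = (\<one>\<^bsub>G\<^esub>, \<one>\<^bsub>H\<^esub>) then \<theta> (\<one>\<^bsub>G\<^esub>, \<one>\<^bsub>H\<^esub>) * of_nat (card (carrier G)) * of_nat (card (carrier H)) else 0)"
    by (intro sum.cong refl) (auto simp: xs(2) ys(2) split: if_splits)
  also have "\<dots> = of_nat n * of_nat (card (carrier G)) * of_nat (card (carrier H))"
    using T.character_one by (simp add: \<tau>(2) one)
  also have "\<dots> \<noteq> 0" using G.one_closed H.one_closed T.degree_pos by auto
  finally obtain \<psi> where \<psi>: "\<psi> \<in> set ys"
      "(\<Sum>x\<in>?C. (\<theta> x * (\<Sum>\<chi>\<leftarrow>xs. \<chi> (inv\<^bsub>G\<^esub> fst x))) * \<psi> (inv\<^bsub>H\<^esub> snd x)) \<noteq> 0"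
    by (rule sum_list_pairing_nonzero[where k = "\<lambda>x. inv\<^bsub>H\<^esub> snd x"])
  then have "(\<Sum>x\<in>?C. (\<theta> x * \<psi> (inv\<^bsub>H\<^esub> snd x)) * (\<Sum>\<chi>\<leftarrow>xs. \<chi> (inv\<^bsub>G\<^esub> fst x))) \<noteq> 0"
    by (simp add: mult_ac)
  then obtain \<chi> where \<chi>: "\<chi> \<in> set xs"
      "(\<Sum>x\<in>?C. (\<theta> x * \<psi> (inv\<^bsub>H\<^esub> snd x)) * \<chi> (inv\<^bsub>G\<^esub> fst x)) \<noteq> 0"
    by (rule sum_list_pairing_nonzero[where k = "\<lambda>x. inv\<^bsub>G\<^esub> fst x"])
  have irr: "\<chi> \<in> Irr G" "\<psi> \<in> Irr H" using xs(1) ys(1) \<chi>(1) \<psi>(1) by auto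
  obtain m \<sigma> where \<sigma>: "irreducible_rep (G \<times>\<times> H) m \<sigma>" "outer_character G H \<chi> \<psi> = rep_character (G \<times>\<times> H) m \<sigma>"
    using P.IrrE[OF outer_character_in_Irr[OF G H irr]] by metis
  have "(\<Sum>x\<in>carrier (G \<times>\<times> H). \<theta> x * outer_character G H \<chi> \<psi> (inv\<^bsub>G \<times>\<times> H\<^esub> x)) =
      (\<Sum>x\<in>?C. (\<theta> x * \<psi> (inv\<^bsub>H\<^esub> snd x)) * \<chi> (inv\<^bsub>G\<^esub> fst x))"
    by (intro sum.cong) (auto simp: outer_character_def inv_DirProd[OF G.is_group H.is_group])
  with \<chi>(2) have "(\<Sum>x\<in>carrier (G \<times>\<times> H). \<theta> x * outer_character G H \<chi> \<psi> (inv\<^bsub>G \<times>\<times> H\<^esub> x)) \<noteq> 0" by simp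
  then have "\<theta> = outer_character G H \<chi> \<psi>"
    unfolding \<tau>(2) \<sigma>(2) by (rule irreducible_characters_eq[OF \<tau>(1) \<sigma>(1)])
  then show ?thesis using that irr by blast
qed

section \<open>Inner products and Frobenius reciprocity\<close>

text \<open>
  The average of the matrices is idempotent, and its trace is the dimension of the space of fixed
  vectors.
\<close>

lemma (in representation) average_character:
  obtains k where "(\<Sum>g\<in>carrier G. mtrace (\<rho> g)) / of_nat (card (carrier G)) = of_nat k"
proof -
  let ?N = "of_nat (card (carrier G)) :: complex"
  have N: "?N \<noteq> 0" using one_closed by auto
  define P where "P = mat_sum n n (carrier G) (\<lambda>g. (1 / ?N) \<cdot>\<^sub>m \<rho> g)"
  have P: "P \<in> carrier_mat n n" by (simp add: P_def)
  have inv: "\<rho> h * P = P" if h: "h \<in> carrier G" for h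
  proof -
    have "\<rho> h * P = mat_sum n n (carrier G) (\<lambda>g. \<rho> h * ((1 / ?N) \<cdot>\<^sub>m \<rho> g))"
      unfolding P_def using h by (intro mult_mat_sum) auto
    also have "\<dots> = mat_sum n n (carrier G) (\<lambda>g. (1 / ?N) \<cdot>\<^sub>m \<rho> (h \<otimes> g))"
      using h by (intro mat_sum_cong) (simp add: mult mult_smult_distrib[OF closed closed])
    also have "\<dots> = P" unfolding P_def by (rule mat_sum_reindex[OF bij_betw_lmult[OF h]])
    finally show ?thesis .
  qed
  have "P * P = mat_sum n n (carrier G) (\<lambda>g. (1 / ?N) \<cdot>\<^sub>m \<rho> g * P)"
    unfolding P_def by (intro mat_sum_mult) auto
  also have "\<dots> = mat_sum n n (carrier G) (\<lambda>g. (1 / ?N) \<cdot>\<^sub>m P)"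
    by (intro mat_sum_cong) (simp add: inv mult_smult_assoc_mat[OF closed P])
  also have "\<dots> = P" using P N by (intro eq_matI) auto
  finally have "P * P = P" .
  then obtain k where "mtrace P = of_nat k" using mtrace_idempotent[OF P] by metis
  moreover have "mtrace P = (\<Sum>g\<in>carrier G. mtrace ((1 / ?N) \<cdot>\<^sub>m \<rho> g))"
    unfolding P_def by (intro mtrace_mat_sum) auto
  moreover have "\<dots> = (\<Sum>g\<in>carrier G. mtrace (\<rho> g)) / ?N"
    by (simp add: mtrace_def sum_divide_distrib)
  ultimately show ?thesis using that by simp
qed

text \<open>
  The inner product is the average of the character of the tensor product of the first representation
  with the complex conjugate of the second.
\<close>

lemma char_inner_nat:
  assumes "representation G n \<rho>" "representation G m \<sigma>"
  obtains k where "char_inner G (rep_character G n \<rho>) (rep_character G m \<sigma>) = of_nat k"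
proof -
  interpret R: representation G n \<rho> by fact
  interpret S: representation G m \<sigma> by fact
  have cnj_mult: "map_mat cnj (A * B) = map_mat cnj A * map_mat cnj B" if "dim_col A = dim_row B" for A B
    using that by (intro eq_matI) (auto simp: scalar_prod_def)
  have "map_mat cnj (1\<^sub>m m) = 1\<^sub>m m" by (intro eq_matI) auto
  then interpret T: representation G "n * m" "\<lambda>g. kron (\<rho> g) (map_mat cnj (\<sigma> g))"
    by (intro R.representationI) (auto simp: R.mult S.mult cnj_mult kron_mult kron_one)
  have "char_inner G (rep_character G n \<rho>) (rep_character G m \<sigma>) =
      (\<Sum>g\<in>carrier G. mtrace (kron (\<rho> g) (map_mat cnj (\<sigma> g)))) / of_nat (card (carrier G))"
    unfolding char_inner_def
    by (intro arg_cong2[where f = "(/)"] sum.cong refl)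
      (simp add: mtrace_kron[of _ n _ m] R.character_eq_mtrace S.character_eq_mtrace, simp add: mtrace_def)
  then show ?thesis using T.average_character that by metis
qed

text \<open>
  For fixed \<open>x\<close>, conjugation by \<open>x\<close> permutes the group and preserves \<open>\<phi>\<close>, so each of the \<open>|G|\<close> values
  of \<open>x\<close> in the formula for the induced function contributes the same sum over \<open>H\<close>.
\<close>

lemma frobenius_reciprocity:
  assumes "finite_group G" and H: "subgroup H G"
    and class_fun: "\<And>g x. g \<in> carrier G \<Longrightarrow> x \<in> carrier G \<Longrightarrow> \<phi> (inv\<^bsub>G\<^esub> x \<otimes>\<^bsub>G\<^esub> g \<otimes>\<^bsub>G\<^esub> x) = \<phi> g"
  shows "char_inner G \<phi> (induced G H \<psi>) = char_inner (G\<lparr>carrier := H\<rparr>) \<phi> \<psi>"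
proof -
  interpret finite_group G by fact
  have HG: "H \<subseteq> carrier G" by (rule subgroup.subset[OF H])
  \<comment> \<open>\<open>F\<close> is the summand of the right-hand inner product, extended by zero to \<open>G\<close>.\<close>
  define F where "F y = (if y \<in> H then \<phi> y * cnj (\<psi> y) else 0)" for y
  have "(\<Sum>g\<in>carrier G. \<phi> g * cnj (induced G H \<psi> g)) =
      (\<Sum>g\<in>carrier G. (\<Sum>x\<in>carrier G. F (inv\<^bsub>G\<^esub> x \<otimes>\<^bsub>G\<^esub> g \<otimes>\<^bsub>G\<^esub> x)) / of_nat (card H))"
  proof (rule sum.cong[OF refl])
    fix g assume g: "g \<in> carrier G"
    have "\<phi> g * cnj (induced G H \<psi> g) = (\<Sum>x\<in>carrier G. \<phi> g * cnj
        (if inv\<^bsub>G\<^esub> x \<otimes>\<^bsub>G\<^esub> g \<otimes>\<^bsub>G\<^esub> x \<in> H then \<psi> (inv\<^bsub>G\<^esub> x \<otimes>\<^bsub>G\<^esub> g \<otimes>\<^bsub>G\<^esub> x) else 0)) / of_nat (card H)"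
      using g by (simp add: induced_def sum_distrib_left)
    also have "\<dots> = (\<Sum>x\<in>carrier G. F (inv\<^bsub>G\<^esub> x \<otimes>\<^bsub>G\<^esub> g \<otimes>\<^bsub>G\<^esub> x)) / of_nat (card H)"
      using g by (intro arg_cong2[where f = "(/)"] sum.cong refl) (simp add: F_def class_fun)
    finally show "\<phi> g * cnj (induced G H \<psi> g) = \<dots>" .
  qed
  also have "\<dots> = (\<Sum>x\<in>carrier G. \<Sum>g\<in>carrier G. F (inv\<^bsub>G\<^esub> x \<otimes>\<^bsub>G\<^esub> g \<otimes>\<^bsub>G\<^esub> x)) / of_nat (card H)"
    by (subst sum.swap) (simp add: sum_divide_distrib)
  also have "\<dots> = (\<Sum>x\<in>carrier G. \<Sum>y\<in>carrier G. F y) / of_nat (card H)"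
    by (intro arg_cong2[where f = "(/)"] sum.cong refl sum.reindex_bij_betw bij_betw_conj)
  also have "\<dots> = of_nat (card (carrier G)) * (\<Sum>y\<in>H. \<phi> y * cnj (\<psi> y)) / of_nat (card H)"
    using HG by (simp add: F_def sum.inter_restrict[symmetric] Int_absorb1)
  finally show ?thesis using one_closed by (auto simp: char_inner_def)
qed

lemma (in representation) representation_subgroup:
  assumes H: "subgroup H G" shows "representation (G\<lparr>carrier := H\<rparr>) n \<rho>"
proof -
  interpret H: finite_group "G\<lparr>carrier := H\<rparr>" by (rule finite_group_subgroup[OF H])
  show ?thesis
    using subgroup.subset[OF H] by (intro H.representationI) (auto simp: mult subset_iff)
qed

text \<open>
  Being a constituent asks for a positive inner product.  By reciprocity and \<open>char_inner_nat\<close> the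
  inner product is a natural number, so positive means nonzero.
\<close>

lemma constituents_induced_iff:
  assumes "finite_group G" and H: "subgroup H G" and \<phi>: "\<phi> \<in> Irr G" and \<psi>: "\<psi> \<in> Irr (G\<lparr>carrier := H\<rparr>)"
  shows "\<phi> \<in> constituents G (induced G H \<psi>) \<longleftrightarrow> char_inner (G\<lparr>carrier := H\<rparr>) \<phi> \<psi> \<noteq> 0"
proof -
  interpret finite_group G by fact
  interpret H: finite_group "G\<lparr>carrier := H\<rparr>" by (rule finite_group_subgroup[OF H])
  have HG: "H \<subseteq> carrier G" by (rule subgroup.subset[OF H])
  obtain n \<rho> where \<rho>: "irreducible_rep G n \<rho>" "\<phi> = rep_character G n \<rho>" using IrrE[OF \<phi>] by metis
  obtain m \<sigma> where \<sigma>: "irreducible_rep (G\<lparr>carrier := H\<rparr>) m \<sigma>" "\<psi> = rep_character (G\<lparr>carrier := H\<rparr>) m \<sigma>"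
    using H.IrrE[OF \<psi>] by metis
  interpret R: irreducible_rep G n \<rho> by fact
  interpret S: irreducible_rep "G\<lparr>carrier := H\<rparr>" m \<sigma> by fact
  have "char_inner (G\<lparr>carrier := H\<rparr>) \<phi> \<psi> = char_inner (G\<lparr>carrier := H\<rparr>) (rep_character (G\<lparr>carrier := H\<rparr>) n \<rho>) \<psi>"
    unfolding char_inner_def \<rho>(2)
    using HG by (intro arg_cong2[where f = "(/)"] sum.cong refl) (auto simp: rep_character_def subset_iff)
  then obtain k where k: "char_inner (G\<lparr>carrier := H\<rparr>) \<phi> \<psi> = of_nat k"
    using char_inner_nat[OF R.representation_subgroup[OF H] S.representation_axioms] \<sigma>(2) by metis
  have "char_inner G \<phi> (induced G H \<psi>) = of_nat k"
    using k frobenius_reciprocity[OF \<open>finite_group G\<close> H, of \<phi> \<psi>] by (simp add: \<rho>(2) R.character_conj)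
  then show ?thesis using k \<phi> by (auto simp: constituents_def less_complex_def)
qed

lemma (in finite_group) trivial_character_in_Irr: "(\<lambda>g\<in>carrier G. 1) \<in> Irr G"
proof -
  interpret T: representation G 1 "\<lambda>g. 1\<^sub>m 1"
    by (intro representationI) auto
  have "irreducible_representation G 1 (\<lambda>g. 1\<^sub>m 1)"
  proof (rule T.irreducible_if_spanning)
    \<comment> \<open>The only matrix unit is the identity, the value at \<open>\<one>\<close>.\<close>
    fix i j :: nat assume "i < 1" "j < 1"
    then show "\<exists>c. \<forall>a<1. \<forall>b<1. (\<Sum>g\<in>carrier G. c g * 1\<^sub>m 1 $$ (a, b)) = (if a = i \<and> b = j then 1 else (0::complex))"
      by (intro exI[of _ "\<lambda>g. if g = \<one> then 1 else 0"]) auto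
  qed simp
  moreover have "rep_character G 1 (\<lambda>g. 1\<^sub>m 1) = (\<lambda>g\<in>carrier G. 1)"
    by (auto simp: rep_character_def)
  ultimately show ?thesis unfolding Irr_def by force
qed

section \<open>Inflation along surjective homomorphisms\<close>

locale surjective_hom = finite_group G + Q: group Q
  for G :: "('a, 'm) monoid_scheme" (structure) and Q :: "('b, 'n) monoid_scheme" and \<pi> :: "'a \<Rightarrow> 'b" +
  assumes hom: "\<pi> \<in> hom G Q" and surj: "\<pi> ` carrier G = carrier Q"
begin

lemma finite_group_image: "finite_group Q"
  using fin surj Q.is_group by (metis finite_group_def finite_group_axioms_def finite_imageI)

lemma \<pi>_closed [simp]: "g \<in> carrier G \<Longrightarrow> \<pi> g \<in> carrier Q"
  and \<pi>_mult: "g \<in> carrier G \<Longrightarrow> h \<in> carrier G \<Longrightarrow> \<pi> (g \<otimes> h) = \<pi> g \<otimes>\<^bsub>Q\<^esub> \<pi> h"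
  and \<pi>_one [simp]: "\<pi> \<one> = \<one>\<^bsub>Q\<^esub>"
  and \<pi>_inv: "g \<in> carrier G \<Longrightarrow> \<pi> (inv g) = inv\<^bsub>Q\<^esub> \<pi> g"
proof -
  interpret group_hom G Q \<pi> using hom by unfold_locales
  show "g \<in> carrier G \<Longrightarrow> \<pi> g \<in> carrier Q"
    "g \<in> carrier G \<Longrightarrow> h \<in> carrier G \<Longrightarrow> \<pi> (g \<otimes> h) = \<pi> g \<otimes>\<^bsub>Q\<^esub> \<pi> h"
    "\<pi> \<one> = \<one>\<^bsub>Q\<^esub>" "g \<in> carrier G \<Longrightarrow> \<pi> (inv g) = inv\<^bsub>Q\<^esub> \<pi> g" by simp_all
qed

text \<open>
  The fibres are cosets of the kernel, so \<open>c\<close> is the order of the kernel.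
\<close>

lemma sum_fibres:
  obtains c where "c \<noteq> 0" "\<And>F :: 'b \<Rightarrow> complex. (\<Sum>g\<in>carrier G. F (\<pi> g)) = c * (\<Sum>q\<in>carrier Q. F q)"
proof -
  define K where "K = {g \<in> carrier G. \<pi> g = \<one>\<^bsub>Q\<^esub>}"
  have K: "K \<noteq> {}" "finite K" by (auto simp: K_def intro!: exI[of _ \<one>])
  have fibre: "card {g \<in> carrier G. \<pi> g = q} = card K" if q: "q \<in> carrier Q" for q
  proof -
    obtain x where x: "x \<in> carrier G" "\<pi> x = q" using q surj by (metis imageE)
    have "bij_betw (\<lambda>g. x \<otimes> g) K {g \<in> carrier G. \<pi> g = q}"
      using x by (intro bij_betw_byWitness[of _ "\<lambda>g. inv x \<otimes> g"])
        (auto simp: K_def \<pi>_mult \<pi>_inv m_assoc[symmetric])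
    then show ?thesis by (simp add: bij_betw_same_card)
  qed
  show ?thesis
  proof (rule that)
    show "of_nat (card K) \<noteq> (0 :: complex)" using K by simp
    fix F :: "'b \<Rightarrow> complex"
    have "(\<Sum>g\<in>carrier G. F (\<pi> g)) = (\<Sum>q\<in>carrier Q. \<Sum>g\<in>{g \<in> carrier G. \<pi> g = q}. F (\<pi> g))"
      using finite_group.fin[OF finite_group_image] by (intro sum.group[symmetric]) auto
    also have "\<dots> = (\<Sum>q\<in>carrier Q. of_nat (card K) * F q)"
      by (intro sum.cong refl) (simp add: fibre)
    finally show "(\<Sum>g\<in>carrier G. F (\<pi> g)) = of_nat (card K) * (\<Sum>q\<in>carrier Q. F q)"
      by (simp add: sum_distrib_left)
  qed
qed

lemma inflation_in_Irr:
  assumes "\<chi> \<in> Irr Q"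
  shows "(\<lambda>g\<in>carrier G. \<chi> (\<pi> g)) \<in> Irr G"
proof -
  obtain n \<rho> where \<rho>: "irreducible_rep Q n \<rho>" "\<chi> = rep_character Q n \<rho>"
    using finite_group.IrrE[OF finite_group_image assms] by metis
  interpret R: irreducible_rep Q n \<rho> by fact
  interpret S: representation G n "\<lambda>g. \<rho> (\<pi> g)"
    by (intro representationI) (simp_all add: \<pi>_mult R.mult)
  have "irreducible_representation G n (\<lambda>g. \<rho> (\<pi> g))"
    unfolding irreducible_representation_def
  proof (intro conjI allI impI)
    fix W assume W: "vsubspace n W" "\<forall>g\<in>carrier G. \<forall>w\<in>W. \<rho> (\<pi> g) *\<^sub>v w \<in> W"
    have "\<forall>q\<in>carrier Q. \<forall>w\<in>W. \<rho> q *\<^sub>v w \<in> W" using W(2) surj by (metis imageE)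
    then show "W = {0\<^sub>v n} \<or> W = carrier_vec n" using R.invariant_subspace[OF W(1)] by blast
  qed (use S.rep R.degree_pos in auto)
  moreover have "(\<lambda>g\<in>carrier G. \<chi> (\<pi> g)) = rep_character G n (\<lambda>g. \<rho> (\<pi> g))"
    by (auto simp: \<rho>(2) rep_character_def)
  ultimately show ?thesis by (auto simp: Irr_def)
qed

text \<open>
  Let \<open>K\<close> be the kernel of \<open>\<pi>\<close>.  As \<open>K\<close> is normal, the vectors fixed by \<open>K\<close> form an invariant
  subspace.  If it were zero, the sum of the matrices of \<open>K\<close> would be zero, because its columns are
  fixed by \<open>K\<close>; then the sum of \<open>\<psi>\<close> over each coset of \<open>K\<close> would vanish, and \<open>\<psi>\<close> would be orthogonal to
  every function that is constant on cosets.  Hence \<open>K\<close> acts trivially.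
\<close>

lemma irreducible_factors_through:
  assumes \<psi>: "\<psi> \<in> Irr G" and ne: "char_inner G (\<lambda>g. f (\<pi> g)) \<psi> \<noteq> 0"
  obtains \<psi>' where "\<psi>' \<in> Irr Q" "\<And>g. g \<in> carrier G \<Longrightarrow> \<psi> g = \<psi>' (\<pi> g)"
proof -
  obtain n \<sigma> where \<sigma>: "irreducible_rep G n \<sigma>" "\<psi> = rep_character G n \<sigma>" using IrrE[OF \<psi>] by metis
  interpret S: irreducible_rep G n \<sigma> by fact
  define K where "K = {k \<in> carrier G. \<pi> k = \<one>\<^bsub>Q\<^esub>}"
  have KG: "k \<in> carrier G" if "k \<in> K" for k using that by (simp add: K_def)
  have finK: "finite K" by (simp add: K_def)
  have K_ne: "K \<noteq> {}" by (auto simp: K_def intro!: exI[of _ \<one>])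
  define W where "W = {w \<in> carrier_vec n. \<forall>k\<in>K. \<sigma> k *\<^sub>v w = w}"
  have W: "vsubspace n W"
    unfolding W_def by (intro vsubspace_fixed) (simp add: KG)
  have W_inv: "\<sigma> g *\<^sub>v w \<in> W" if g: "g \<in> carrier G" and w: "w \<in> W" for g w
  proof -
    have wn: "w \<in> carrier_vec n" using w by (simp add: W_def)
    have "\<sigma> k *\<^sub>v (\<sigma> g *\<^sub>v w) = \<sigma> g *\<^sub>v w" if k: "k \<in> K" for k
    proof -
      have k': "inv g \<otimes> k \<otimes> g \<in> K" using g k by (simp add: K_def \<pi>_mult \<pi>_inv)
      have "\<sigma> k *\<^sub>v (\<sigma> g *\<^sub>v w) = \<sigma> (k \<otimes> g) *\<^sub>v w"
        using g KG[OF k] wn by (simp add: S.mult assoc_mult_mat_vec_dim)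
      also have "k \<otimes> g = g \<otimes> (inv g \<otimes> k \<otimes> g)" using g KG[OF k] by (simp add: m_assoc[symmetric])
      also have "\<sigma> \<dots> *\<^sub>v w = \<sigma> g *\<^sub>v (\<sigma> (inv g \<otimes> k \<otimes> g) *\<^sub>v w)"
        using g KG[OF k] wn by (simp add: S.mult[of g] assoc_mult_mat_vec_dim)
      also have "\<dots> = \<sigma> g *\<^sub>v w" using k' w by (simp add: W_def)
      finally show ?thesis .
    qed
    then show ?thesis using g wn S.closed[OF g] by (auto simp: W_def)
  qed
  have "W \<noteq> {0\<^sub>v n}"
  proof
    assume W0: "W = {0\<^sub>v n}"
    define B where "B = mat_sum n n K \<sigma>"
    have B: "B \<in> carrier_mat n n" by (simp add: B_def)
    have kB: "\<sigma> k * B = B" if k: "k \<in> K" for k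
    proof -
      have bij: "bij_betw (\<lambda>l. k \<otimes> l) K K"
        using k by (intro bij_betw_byWitness[of _ "\<lambda>l. inv k \<otimes> l"])
          (auto simp: K_def \<pi>_mult \<pi>_inv m_assoc[symmetric])
      have "\<sigma> k * B = mat_sum n n K (\<lambda>l. \<sigma> k * \<sigma> l)"
        unfolding B_def using k by (intro mult_mat_sum) (auto simp: KG)
      also have "\<dots> = mat_sum n n K (\<lambda>l. \<sigma> (k \<otimes> l))"
        using KG[OF k] by (intro mat_sum_cong) (simp add: S.mult KG)
      also have "\<dots> = B" unfolding B_def by (rule mat_sum_reindex[OF bij])
      finally show ?thesis .
    qed
    have B0: "B = 0\<^sub>m n n"
    proof (rule mat_eqI_mult_vec[of _ n n])
      fix v :: "complex vec" assume v: "v \<in> carrier_vec n"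
      have "\<sigma> k *\<^sub>v (B *\<^sub>v v) = B *\<^sub>v v" if "k \<in> K" for k
        using assoc_mult_mat_vec[OF S.closed B v, of k] kB[OF that] KG[OF that] by simp
      then have "B *\<^sub>v v \<in> W" using B v by (auto simp: W_def)
      then show "B *\<^sub>v v = 0\<^sub>m n n *\<^sub>v v" using W0 v by (auto intro!: eq_vecI)
    qed (use B in auto)
    have zero: "(\<Sum>k\<in>K. \<psi> (g \<otimes> k)) = 0" if g: "g \<in> carrier G" for g
    proof -
      have "(\<Sum>k\<in>K. \<psi> (g \<otimes> k)) = (\<Sum>k\<in>K. mtrace (\<sigma> g * \<sigma> k))"
        using g by (intro sum.cong refl) (simp add: \<sigma>(2) S.character_eq_mtrace S.mult KG)
      also have "\<dots> = mtrace (\<sigma> g * B)"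
        unfolding B_def using g
        by (subst mult_mat_sum[of _ n n]) (auto simp: KG intro!: mtrace_mat_sum[symmetric])
      also have "\<dots> = 0" using g by (simp add: B0 right_mult_zero_mat[OF S.closed] mtrace_def)
      finally show ?thesis .
    qed
    have rmult: "bij_betw (\<lambda>g. g \<otimes> k) (carrier G) (carrier G)" if "k \<in> carrier G" for k
      using that by (intro bij_betw_byWitness[of _ "\<lambda>g. g \<otimes> inv k"]) (auto simp: m_assoc)
    have "of_nat (card K) * (\<Sum>g\<in>carrier G. f (\<pi> g) * cnj (\<psi> g)) =
        (\<Sum>k\<in>K. \<Sum>g\<in>carrier G. f (\<pi> (g \<otimes> k)) * cnj (\<psi> (g \<otimes> k)))"
      by (simp add: sum.reindex_bij_betw[OF rmult[OF KG], of _ "\<lambda>g. f (\<pi> g) * cnj (\<psi> g)"])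
    also have "\<dots> = (\<Sum>k\<in>K. \<Sum>g\<in>carrier G. f (\<pi> g) * cnj (\<psi> (g \<otimes> k)))"
      by (intro sum.cong refl) (auto simp: K_def \<pi>_mult)
    also have "\<dots> = (\<Sum>g\<in>carrier G. f (\<pi> g) * cnj (\<Sum>k\<in>K. \<psi> (g \<otimes> k)))"
      by (subst sum.swap) (simp add: sum_distrib_left)
    also have "\<dots> = 0" by (simp add: zero)
    finally show False using ne finK K_ne by (auto simp: char_inner_def)
  qed
  then have Wall: "W = carrier_vec n" using S.invariant_subspace[OF W W_inv] by blast
  have \<sigma>K: "\<sigma> k = 1\<^sub>m n" if k: "k \<in> K" for k
  proof (rule mat_eqI_mult_vec[of _ n n])
    fix v :: "complex vec" assume v: "v \<in> carrier_vec n"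
    then have "v \<in> W" by (simp only: Wall)
    then show "\<sigma> k *\<^sub>v v = 1\<^sub>m n *\<^sub>v v" using k v by (simp add: W_def)
  qed (use KG[OF k] in simp_all)
  have \<sigma>_eq: "\<sigma> g = \<sigma> h" if g: "g \<in> carrier G" and h: "h \<in> carrier G" and eq: "\<pi> g = \<pi> h" for g h
  proof -
    have "inv h \<otimes> g \<in> K" using g h eq by (simp add: K_def \<pi>_mult \<pi>_inv)
    then have "\<sigma> (h \<otimes> (inv h \<otimes> g)) = \<sigma> h"
      using g h by (subst S.mult) (simp_all add: \<sigma>K right_mult_one_mat[OF S.closed])
    then show ?thesis using g h by (simp add: m_assoc[symmetric])
  qed
  define s where "s q = (SOME g. g \<in> carrier G \<and> \<pi> g = q)" for q
  have s: "s q \<in> carrier G" "\<pi> (s q) = q" if "q \<in> carrier Q" for q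
  proof -
    have "\<exists>g. g \<in> carrier G \<and> \<pi> g = q" using that surj by (metis imageE)
    from someI_ex[OF this] show "s q \<in> carrier G" "\<pi> (s q) = q" by (simp_all add: s_def)
  qed
  define \<sigma>' where "\<sigma>' q = \<sigma> (s q)" for q
  have \<sigma>'_\<pi>: "\<sigma>' (\<pi> g) = \<sigma> g" if "g \<in> carrier G" for g
    unfolding \<sigma>'_def using that by (intro \<sigma>_eq) (simp_all add: s)
  interpret Qf: finite_group Q by (rule finite_group_image)
  interpret R: representation Q n \<sigma>'
  proof (rule Qf.representationI)
    show "\<sigma>' q \<in> carrier_mat n n" if "q \<in> carrier Q" for q
      unfolding \<sigma>'_def using that by (intro S.closed s)
    show "\<sigma>' (p \<otimes>\<^bsub>Q\<^esub> q) = \<sigma>' p * \<sigma>' q" if "p \<in> carrier Q" "q \<in> carrier Q" for p q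
      using that \<sigma>'_\<pi>[of "s p \<otimes> s q"] by (simp add: \<pi>_mult s S.mult \<sigma>'_def)
    show "\<sigma>' \<one>\<^bsub>Q\<^esub> = 1\<^sub>m n" using \<sigma>'_\<pi>[of \<one>] by simp
  qed
  have "irreducible_representation Q n \<sigma>'"
    unfolding irreducible_representation_def
  proof (intro conjI allI impI)
    fix W assume W: "vsubspace n W" "\<forall>q\<in>carrier Q. \<forall>w\<in>W. \<sigma>' q *\<^sub>v w \<in> W"
    have "\<sigma> g *\<^sub>v w \<in> W" if "g \<in> carrier G" "w \<in> W" for g w
      using W(2) that \<sigma>'_\<pi>[of g] \<pi>_closed[of g] by metis
    then show "W = {0\<^sub>v n} \<or> W = carrier_vec n" by (rule S.invariant_subspace[OF W(1)])
  qed (use R.rep S.degree_pos in auto)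
  then have "rep_character Q n \<sigma>' \<in> Irr Q" by (auto simp: Irr_def)
  moreover have "\<psi> g = rep_character Q n \<sigma>' (\<pi> g)" if "g \<in> carrier G" for g
    using that by (simp add: \<sigma>(2) rep_character_def \<sigma>'_\<pi>)
  ultimately show ?thesis by (rule that)
qed

end

lemma char_inner_cong:
  assumes "\<And>g. g \<in> carrier G \<Longrightarrow> \<phi> g = \<phi>' g" "\<And>g. g \<in> carrier G \<Longrightarrow> \<chi> g = \<chi>' g"
  shows "char_inner G \<phi> \<chi> = char_inner G \<phi>' \<chi>'"
  using assms by (simp add: char_inner_def)

lemma (in surjective_hom) char_inner_inflation:
  "char_inner G (\<lambda>g. \<phi> (\<pi> g)) (\<lambda>g. \<chi> (\<pi> g)) = 0 \<longleftrightarrow> char_inner Q \<phi> \<chi> = 0"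
proof -
  obtain c :: complex where c: "c \<noteq> 0"
      "\<And>F. (\<Sum>g\<in>carrier G. F (\<pi> g)) = c * (\<Sum>q\<in>carrier Q. F q)"
    using sum_fibres by blast
  show ?thesis
    using c(1) c(2)[of "\<lambda>q. \<phi> q * cnj (\<chi> q)"] one_closed Q.one_closed finite_group.fin[OF finite_group_image]
    by (auto simp: char_inner_def)
qed

lemma (in finite_group) Irr_undefined: "\<chi> \<in> Irr G \<Longrightarrow> g \<notin> carrier G \<Longrightarrow> \<chi> g = undefined"
  by (auto simp: Irr_def rep_character_def)

lemma (in finite_group) Irr_eqI:
  assumes "\<chi> \<in> Irr G" "\<phi> \<in> Irr G" "\<And>g. g \<in> carrier G \<Longrightarrow> \<chi> g = \<phi> g"
  shows "\<chi> = \<phi>"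
  using assms Irr_undefined by (metis ext)

lemma (in finite_group) char_inner_self_nonzero:
  assumes "\<chi> \<in> Irr G" shows "char_inner G \<chi> \<chi> \<noteq> 0"
proof
  assume z: "char_inner G \<chi> \<chi> = 0"
  obtain n \<rho> where \<rho>: "irreducible_rep G n \<rho>" "\<chi> = rep_character G n \<rho>" using IrrE[OF assms] by metis
  interpret R: irreducible_rep G n \<rho> by fact
  have "complex_of_real (\<Sum>g\<in>carrier G. (cmod (\<chi> g))\<^sup>2) = 0"
    using z one_closed by (auto simp: char_inner_def complex_norm_square simp del: of_real_power)
  then have "(\<Sum>g\<in>carrier G. (cmod (\<chi> g))\<^sup>2) = 0" by (simp only: of_real_eq_0_iff)
  then have "\<chi> \<one> = 0" by (simp add: sum_nonneg_eq_0_iff)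
  then show False using R.character_one R.degree_pos by (simp add: \<rho>(2))
qed

lemma (in surjective_hom) surjective_hom_subgroup:
  assumes H: "subgroup H G"
  shows "surjective_hom (G\<lparr>carrier := H\<rparr>) (Q\<lparr>carrier := \<pi> ` H\<rparr>) \<pi>" and "subgroup (\<pi> ` H) Q"
proof -
  interpret group_hom G Q \<pi> using hom by unfold_locales
  show "subgroup (\<pi> ` H) Q" using subgroup_img_is_subgroup[OF H] .
  then have Q': "group (Q\<lparr>carrier := \<pi> ` H\<rparr>)" by (rule subgroup.subgroup_is_group[OF _ Q.is_group])
  show "surjective_hom (G\<lparr>carrier := H\<rparr>) (Q\<lparr>carrier := \<pi> ` H\<rparr>) \<pi>"
    unfolding surjective_hom_def surjective_hom_axioms_def
    using finite_group_subgroup[OF H] Q' subgroup.subset[OF H] by (auto simp: hom_def \<pi>_mult subset_iff)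
qed

section \<open>Quotients and direct products of relative almost monomial groups\<close>

text \<open>
  A separating pair \<open>(H, \<psi>)\<close> for the inflated characters descends to \<open>(\<pi> ` H, \<psi>')\<close> with
  \<open>\<psi> = \<psi>' \<circ> \<pi>\<close>.  The restriction of \<open>\<psi>'\<close> to \<open>\<pi> ` N\<close> is irreducible because the restriction of
  \<open>\<psi>\<close> to \<open>N\<close> is irreducible and factors through \<open>\<pi>\<close> in the same way.
\<close>

lemma (in surjective_hom) relative_almost_monomial_image:
  assumes N: "subgroup N G" and ram: "relative_almost_monomial G N"
  shows "relative_almost_monomial Q (\<pi> ` N)"
  unfolding relative_almost_monomial_def
proof (intro ballI impI)
  fix \<chi> \<phi> assume \<chi>: "\<chi> \<in> Irr Q" and \<phi>: "\<phi> \<in> Irr Q" and neq: "\<chi> \<noteq> \<phi>"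
  interpret Qf: finite_group Q by (rule finite_group_image)
  let ?infl = "\<lambda>\<chi>. \<lambda>g\<in>carrier G. \<chi> (\<pi> g)"
  have "?infl \<chi> \<noteq> ?infl \<phi>"
  proof
    assume eq: "?infl \<chi> = ?infl \<phi>"
    have "\<chi> (\<pi> g) = \<phi> (\<pi> g)" if "g \<in> carrier G" for g using fun_cong[OF eq, of g] that by simp
    then have "\<chi> = \<phi>" using surj by (intro Qf.Irr_eqI[OF \<chi> \<phi>]) (metis imageE)
    then show False using neq by simp
  qed
  then obtain H \<psi> where H: "subgroup H G" "N \<subseteq> H" and \<psi>: "\<psi> \<in> Irr (G\<lparr>carrier := H\<rparr>)"
    and \<psi>N: "restrict \<psi> N \<in> Irr (G\<lparr>carrier := N\<rparr>)"
    and c: "?infl \<chi> \<in> constituents G (induced G H \<psi>)" "?infl \<phi> \<notin> constituents G (induced G H \<psi>)"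
    using ram inflation_in_Irr[OF \<chi>] inflation_in_Irr[OF \<phi>] unfolding relative_almost_monomial_def by metis
  interpret H: surjective_hom "G\<lparr>carrier := H\<rparr>" "Q\<lparr>carrier := \<pi> ` H\<rparr>" \<pi>
    by (rule surjective_hom_subgroup[OF H(1)])
  interpret N: surjective_hom "G\<lparr>carrier := N\<rparr>" "Q\<lparr>carrier := \<pi> ` N\<rparr>" \<pi>
    by (rule surjective_hom_subgroup[OF N])
  interpret NQ: finite_group "Q\<lparr>carrier := \<pi> ` N\<rparr>" by (rule N.finite_group_image)
  have HQ: "subgroup (\<pi> ` H) Q" by (rule surjective_hom_subgroup[OF H(1)])
  have HG: "H \<subseteq> carrier G" by (rule subgroup.subset[OF H(1)])
  have infl: "char_inner (G\<lparr>carrier := H\<rparr>) (?infl \<theta>) \<psi> = char_inner (G\<lparr>carrier := H\<rparr>) (\<lambda>g. \<theta> (\<pi> g)) \<psi>" for \<theta>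
    using HG by (intro char_inner_cong) auto
  have c': "char_inner (G\<lparr>carrier := H\<rparr>) (\<lambda>g. \<chi> (\<pi> g)) \<psi> \<noteq> 0" "char_inner (G\<lparr>carrier := H\<rparr>) (\<lambda>g. \<phi> (\<pi> g)) \<psi> = 0"
    using c constituents_induced_iff[OF finite_group_axioms H(1) inflation_in_Irr[OF \<chi>] \<psi>]
      constituents_induced_iff[OF finite_group_axioms H(1) inflation_in_Irr[OF \<phi>] \<psi>] by (simp_all add: infl)
  obtain \<psi>' where \<psi>': "\<psi>' \<in> Irr (Q\<lparr>carrier := \<pi> ` H\<rparr>)" and \<psi>\<psi>': "\<And>g. g \<in> H \<Longrightarrow> \<psi> g = \<psi>' (\<pi> g)"
    using H.irreducible_factors_through[OF \<psi> c'(1)] by auto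
  \<comment> \<open>On \<open>N\<close> the function \<open>\<psi>' \<circ> \<pi>\<close> agrees with \<open>\<psi>\<close>, which is not orthogonal to itself.\<close>
  have "char_inner (G\<lparr>carrier := N\<rparr>) (\<lambda>g. \<psi>' (\<pi> g)) (restrict \<psi> N) = char_inner (G\<lparr>carrier := N\<rparr>) (restrict \<psi> N) (restrict \<psi> N)"
    using H(2) by (intro char_inner_cong) (auto simp: \<psi>\<psi>')
  then have "char_inner (G\<lparr>carrier := N\<rparr>) (\<lambda>g. \<psi>' (\<pi> g)) (restrict \<psi> N) \<noteq> 0"
    using N.char_inner_self_nonzero[OF \<psi>N] by simp
  then obtain \<theta> where \<theta>: "\<theta> \<in> Irr (Q\<lparr>carrier := \<pi> ` N\<rparr>)" "\<And>g. g \<in> N \<Longrightarrow> restrict \<psi> N g = \<theta> (\<pi> g)"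
    using N.irreducible_factors_through[OF \<psi>N] by auto
  have "restrict \<psi>' (\<pi> ` N) = \<theta>"
  proof
    fix q show "restrict \<psi>' (\<pi> ` N) q = \<theta> q"
      using \<theta>(2) \<psi>\<psi>' H(2) NQ.Irr_undefined[OF \<theta>(1), of q] by (cases "q \<in> \<pi> ` N") (auto simp: subset_iff)
  qed
  then have \<psi>'N: "restrict \<psi>' (\<pi> ` N) \<in> Irr (Q\<lparr>carrier := \<pi> ` N\<rparr>)" using \<theta>(1) by simp
  have "char_inner (Q\<lparr>carrier := \<pi> ` H\<rparr>) \<eta> \<psi>' = 0 \<longleftrightarrow> char_inner (G\<lparr>carrier := H\<rparr>) (\<lambda>g. \<eta> (\<pi> g)) \<psi> = 0" for \<eta>
    unfolding H.char_inner_inflation[symmetric]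
    by (intro arg_cong[where f = "\<lambda>z. z = 0"] char_inner_cong) (auto simp: \<psi>\<psi>')
  then have "\<chi> \<in> constituents Q (induced Q (\<pi> ` H) \<psi>')" "\<phi> \<notin> constituents Q (induced Q (\<pi> ` H) \<psi>')"
    using c' constituents_induced_iff[OF Qf.finite_group_axioms HQ \<chi> \<psi>'] constituents_induced_iff[OF Qf.finite_group_axioms HQ \<phi> \<psi>']
    by simp_all
  then show "\<exists>H \<psi>. subgroup H Q \<and> \<pi> ` N \<subseteq> H \<and> \<psi> \<in> Irr (Q\<lparr>carrier := H\<rparr>) \<and>
      restrict \<psi> (\<pi> ` N) \<in> Irr (Q\<lparr>carrier := \<pi> ` N\<rparr>) \<and>
      \<chi> \<in> constituents Q (induced Q H \<psi>) \<and> \<phi> \<notin> constituents Q (induced Q H \<psi>)"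
    using HQ H(2) \<psi>' \<psi>'N by blast
qed

lemma char_inner_outer:
  "char_inner (G \<times>\<times> H) (\<lambda>x. \<chi> (fst x) * \<psi> (snd x)) (\<lambda>x. \<chi>' (fst x) * \<psi>' (snd x)) =
    char_inner G \<chi> \<chi>' * char_inner H \<psi> \<psi>'"
proof -
  have "(\<Sum>x\<in>carrier G \<times> carrier H. \<chi> (fst x) * \<psi> (snd x) * cnj (\<chi>' (fst x) * \<psi>' (snd x))) =
      (\<Sum>g\<in>carrier G. \<chi> g * cnj (\<chi>' g)) * (\<Sum>h\<in>carrier H. \<psi> h * cnj (\<psi>' h))"
    unfolding sum_product sum.cartesian_product by (intro sum.cong) auto
  then show ?thesis by (simp add: char_inner_def card_cartesian_product)
qed

text \<open>
  In a direct product two distinct characters may agree in one factor, and that factor still needs a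
  subgroup and a character.  When \<open>\<chi> = \<phi>\<close>, any pair that separates \<open>\<chi>\<close> from another character
  serves.
\<close>

lemma relative_almost_monomial_separate:
  assumes "finite_group G" and N: "subgroup N G" and ram: "relative_almost_monomial G N"
    and \<chi>: "\<chi> \<in> Irr G" and \<phi>: "\<phi> \<in> Irr G"
  shows "\<exists>H \<psi>. subgroup H G \<and> N \<subseteq> H \<and> \<psi> \<in> Irr (G\<lparr>carrier := H\<rparr>) \<and>
    restrict \<psi> N \<in> Irr (G\<lparr>carrier := N\<rparr>) \<and> char_inner (G\<lparr>carrier := H\<rparr>) \<chi> \<psi> \<noteq> 0 \<and>
    (\<chi> \<noteq> \<phi> \<longrightarrow> char_inner (G\<lparr>carrier := H\<rparr>) \<phi> \<psi> = 0)" (is ?thesis)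
proof -
  interpret finite_group G by fact
  have sep: ?thesis if \<eta>: "\<eta> \<in> Irr G" "\<chi> \<noteq> \<eta>" and imp: "\<chi> \<noteq> \<phi> \<Longrightarrow> \<eta> = \<phi>" for \<eta>
  proof -
    obtain H \<psi> where H: "subgroup H G" "N \<subseteq> H" "\<psi> \<in> Irr (G\<lparr>carrier := H\<rparr>)"
      "restrict \<psi> N \<in> Irr (G\<lparr>carrier := N\<rparr>)"
      "\<chi> \<in> constituents G (induced G H \<psi>)" "\<eta> \<notin> constituents G (induced G H \<psi>)"
      using ram \<chi> \<eta> unfolding relative_almost_monomial_def by metis
    then show ?thesis
      using imp constituents_induced_iff[OF finite_group_axioms H(1) \<chi> H(3)]
        constituents_induced_iff[OF finite_group_axioms H(1) \<eta>(1) H(3)] by blast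
  qed
  show ?thesis
  proof (cases "\<exists>\<eta>\<in>Irr G. \<chi> \<noteq> \<eta>")
    case True
    then show ?thesis using sep \<phi> by (cases "\<chi> = \<phi>") blast+
  next
    case False
    interpret N: finite_group "G\<lparr>carrier := N\<rparr>" by (rule finite_group_subgroup[OF N])
    \<comment> \<open>The only irreducible character is the trivial one, whose restrictions are irreducible.\<close>
    have triv: "\<chi> = (\<lambda>g\<in>carrier G. 1)" using False trivial_character_in_Irr by blast
    have NG: "N \<subseteq> carrier G" by (rule subgroup.subset[OF N])
    then have "restrict \<chi> N = (\<lambda>g\<in>carrier (G\<lparr>carrier := N\<rparr>). 1)"
      by (auto simp: triv restrict_def fun_eq_iff)
    then have "restrict \<chi> N \<in> Irr (G\<lparr>carrier := N\<rparr>)" by (simp only: N.trivial_character_in_Irr)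
    then show ?thesis
      using False subgroup_self NG \<chi> \<phi> char_inner_self_nonzero[OF \<chi>]
      by (intro exI[of _ "carrier G"] exI[of _ \<chi>]) auto
  qed
qed

lemma relative_almost_monomial_DirProd:
  assumes G: "finite_group G" and H: "finite_group H" and M: "subgroup M G" and N: "subgroup N H"
    and ramG: "relative_almost_monomial G M" and ramH: "relative_almost_monomial H N"
  shows "relative_almost_monomial (G \<times>\<times> H) (M \<times> N)"
  unfolding relative_almost_monomial_def
proof (intro ballI impI)
  fix \<chi> \<phi> assume \<chi>: "\<chi> \<in> Irr (G \<times>\<times> H)" and \<phi>: "\<phi> \<in> Irr (G \<times>\<times> H)" and neq: "\<chi> \<noteq> \<phi>"
  have GH: "finite_group (G \<times>\<times> H)" by (rule finite_group_DirProd[OF G H])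
  interpret G: finite_group G by fact
  interpret H: finite_group H by fact
  obtain \<chi>1 \<chi>2 where \<chi>': "\<chi>1 \<in> Irr G" "\<chi>2 \<in> Irr H" "\<chi> = outer_character G H \<chi>1 \<chi>2"
    by (rule Irr_DirProdE[OF G H \<chi>])
  obtain \<phi>1 \<phi>2 where \<phi>': "\<phi>1 \<in> Irr G" "\<phi>2 \<in> Irr H" "\<phi> = outer_character G H \<phi>1 \<phi>2"
    by (rule Irr_DirProdE[OF G H \<phi>])
  obtain A \<alpha> where A: "subgroup A G" "M \<subseteq> A" "\<alpha> \<in> Irr (G\<lparr>carrier := A\<rparr>)"
    "restrict \<alpha> M \<in> Irr (G\<lparr>carrier := M\<rparr>)" "char_inner (G\<lparr>carrier := A\<rparr>) \<chi>1 \<alpha> \<noteq> 0"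
    "\<chi>1 \<noteq> \<phi>1 \<longrightarrow> char_inner (G\<lparr>carrier := A\<rparr>) \<phi>1 \<alpha> = 0"
    using relative_almost_monomial_separate[OF G M ramG \<chi>'(1) \<phi>'(1)] by blast
  obtain B \<beta> where B: "subgroup B H" "N \<subseteq> B" "\<beta> \<in> Irr (H\<lparr>carrier := B\<rparr>)"
    "restrict \<beta> N \<in> Irr (H\<lparr>carrier := N\<rparr>)" "char_inner (H\<lparr>carrier := B\<rparr>) \<chi>2 \<beta> \<noteq> 0"
    "\<chi>2 \<noteq> \<phi>2 \<longrightarrow> char_inner (H\<lparr>carrier := B\<rparr>) \<phi>2 \<beta> = 0"
    using relative_almost_monomial_separate[OF H N ramH \<chi>'(2) \<phi>'(2)] by blast
  have prod: "(G \<times>\<times> H)\<lparr>carrier := X \<times> Y\<rparr> = G\<lparr>carrier := X\<rparr> \<times>\<times> H\<lparr>carrier := Y\<rparr>" for X Y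
    by (simp add: DirProd_def)
  have AB: "subgroup (A \<times> B) (G \<times>\<times> H)"
    by (rule DirProd_subgroups[OF G.is_group A(1) H.is_group B(1)])
  have AG: "A \<subseteq> carrier G" and BH: "B \<subseteq> carrier H" using A(1) B(1) by (auto dest: subgroup.subset)
  define \<psi> where "\<psi> = outer_character (G\<lparr>carrier := A\<rparr>) (H\<lparr>carrier := B\<rparr>) \<alpha> \<beta>"
  have \<psi>: "\<psi> \<in> Irr ((G \<times>\<times> H)\<lparr>carrier := A \<times> B\<rparr>)"
    unfolding \<psi>_def prod
    by (intro outer_character_in_Irr G.finite_group_subgroup H.finite_group_subgroup A B)
  have "restrict \<psi> (M \<times> N) = outer_character (G\<lparr>carrier := M\<rparr>) (H\<lparr>carrier := N\<rparr>) (restrict \<alpha> M) (restrict \<beta> N)"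
    using A(2) B(2) by (auto simp: \<psi>_def outer_character_def restrict_def fun_eq_iff)
  moreover have "\<dots> \<in> Irr ((G \<times>\<times> H)\<lparr>carrier := M \<times> N\<rparr>)"
    unfolding prod
    by (intro outer_character_in_Irr G.finite_group_subgroup H.finite_group_subgroup A B M N)
  ultimately have \<psi>MN: "restrict \<psi> (M \<times> N) \<in> Irr ((G \<times>\<times> H)\<lparr>carrier := M \<times> N\<rparr>)" by simp
  have inner: "char_inner ((G \<times>\<times> H)\<lparr>carrier := A \<times> B\<rparr>) (outer_character G H \<eta>1 \<eta>2) \<psi> =
      char_inner (G\<lparr>carrier := A\<rparr>) \<eta>1 \<alpha> * char_inner (H\<lparr>carrier := B\<rparr>) \<eta>2 \<beta>" for \<eta>1 \<eta>2
    unfolding prod char_inner_outer[symmetric]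
    using AG BH by (intro char_inner_cong) (auto simp: \<psi>_def outer_character_def)
  have "\<chi> \<in> constituents (G \<times>\<times> H) (induced (G \<times>\<times> H) (A \<times> B) \<psi>)"
    unfolding constituents_induced_iff[OF GH AB \<chi> \<psi>] using A(5) B(5) by (simp add: \<chi>' inner)
  moreover have "\<phi> \<notin> constituents (G \<times>\<times> H) (induced (G \<times>\<times> H) (A \<times> B) \<psi>)"
    unfolding constituents_induced_iff[OF GH AB \<phi> \<psi>]
    using A(6) B(6) neq by (auto simp: \<chi>' \<phi>' inner)
  ultimately show "\<exists>K \<psi>. subgroup K (G \<times>\<times> H) \<and> M \<times> N \<subseteq> K \<and> \<psi> \<in> Irr ((G \<times>\<times> H)\<lparr>carrier := K\<rparr>) \<and>
      restrict \<psi> (M \<times> N) \<in> Irr ((G \<times>\<times> H)\<lparr>carrier := M \<times> N\<rparr>) \<and>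
      \<chi> \<in> constituents (G \<times>\<times> H) (induced (G \<times>\<times> H) K \<psi>) \<and> \<phi> \<notin> constituents (G \<times>\<times> H) (induced (G \<times>\<times> H) K \<psi>)"
    using AB A(2) B(2) \<psi> \<psi>MN by (intro exI[of _ "A \<times> B"] exI[of _ \<psi>]) auto
qed

theorem theorem4p5:
  fixes G\<^sub>1 :: "('a, 'm) monoid_scheme" and G\<^sub>2 :: "('b, 'n) monoid_scheme"
    and N\<^sub>1 :: "'a set" and N\<^sub>2 :: "'b set"
  assumes "group G\<^sub>1" and "finite (carrier G\<^sub>1)"
    and "group G\<^sub>2" and "finite (carrier G\<^sub>2)"
    and "N\<^sub>1 \<lhd> G\<^sub>1" and "N\<^sub>2 \<lhd> G\<^sub>2"
  shows "relative_almost_monomial G\<^sub>1 N\<^sub>1 \<and> relative_almost_monomial G\<^sub>2 N\<^sub>2 \<longleftrightarrow>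
    relative_almost_monomial (G\<^sub>1 \<times>\<times> G\<^sub>2) (N\<^sub>1 \<times> N\<^sub>2)"
proof
  have G1: "finite_group G\<^sub>1" and G2: "finite_group G\<^sub>2"
    using assms(1-4) by (auto simp: finite_group_def finite_group_axioms_def)
  have N1: "subgroup N\<^sub>1 G\<^sub>1" and N2: "subgroup N\<^sub>2 G\<^sub>2"
    using assms(5,6) by (auto simp: normal_def)
  show "relative_almost_monomial (G\<^sub>1 \<times>\<times> G\<^sub>2) (N\<^sub>1 \<times> N\<^sub>2)"
    if "relative_almost_monomial G\<^sub>1 N\<^sub>1 \<and> relative_almost_monomial G\<^sub>2 N\<^sub>2"
    using relative_almost_monomial_DirProd[OF G1 G2 N1 N2] that by simp
  interpret G1: finite_group G\<^sub>1 by fact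
  interpret G2: finite_group G\<^sub>2 by fact
  have N: "subgroup (N\<^sub>1 \<times> N\<^sub>2) (G\<^sub>1 \<times>\<times> G\<^sub>2)"
    by (rule DirProd_subgroups[OF assms(1) N1 assms(3) N2])
  have ne: "N\<^sub>1 \<noteq> {}" "N\<^sub>2 \<noteq> {}" using subgroup.one_closed[OF N1] subgroup.one_closed[OF N2] by auto
  have fst: "surjective_hom (G\<^sub>1 \<times>\<times> G\<^sub>2) G\<^sub>1 fst" and snd: "surjective_hom (G\<^sub>1 \<times>\<times> G\<^sub>2) G\<^sub>2 snd"
    using finite_group_DirProd[OF G1 G2] assms(1,3) G1.one_closed G2.one_closed
    by (auto simp: surjective_hom_def surjective_hom_axioms_def hom_def)
  assume "relative_almost_monomial (G\<^sub>1 \<times>\<times> G\<^sub>2) (N\<^sub>1 \<times> N\<^sub>2)"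
  from surjective_hom.relative_almost_monomial_image[OF fst N this]
    surjective_hom.relative_almost_monomial_image[OF snd N this]
  show "relative_almost_monomial G\<^sub>1 N\<^sub>1 \<and> relative_almost_monomial G\<^sub>2 N\<^sub>2"
    using ne by (simp add: fst_image_times snd_image_times)
qed

end
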